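(* Let $\mathcal{S}$ be a set, let $O\in\mathcal{S}$, and let $\Omega\subseteq\mathcal{S}_{\rm nc}$ be a nonempty set closed under direct sums of matrices. Suppose that for every $n\in\operatorname{supp}\Omega$, $\Omega_n$ is a complete metric space with respect to a metric $\rho_n$. Let $f\colon\Omega\to\Omega$ satisfy: (i) $f(\Omega_n)\subseteq\Omega_n$ for every $n\in\operatorname{supp}\Omega$; (ii) $f(X\oplus Y)=f(X)\oplus f(Y)$ for all $X,Y\in\Omega$; (iii) for every $n\in\operatorname{supp}\Omega$ there exists $c_n$ with $0\le c_n<1$ such that $\rho_n(f(X),f(Y))\le c_n\rho_n(X,Y)$ for all $X,Y\in\Omega_n$. Let $d=\gcd\{n\colon n\in\operatorname{supp}\Omega\}$. Then: 1. There exists $X_*\in\mathcal{S}^{d\times d}$ such that for every $n\in\operatorname{supp}\Omega$ the mapping $f|_{\Omega_n}$ has a unique fixed point, namely $X_{*n}=\bigoplus_{\alpha=1}^{n/d}X_*$. 2. Suppose additionally that $\mathbb{F}=\mathbb{C}$ or $\mathbb{F}=\mathbb{R}$, that $\mathcal{S}=\mathcal{V}$ is an operator space over $\mathbb{F}$ with norms $\|\cdot\|_n$ on $\mathcal{V}^{n\times n}$, that $\rho_n(X,Y)=\|X-Y\|_n$ for all $n\in\operatorname{supp}\Omega$ and $X,Y\in\Omega_n$, that $O=0\in\mathcal{V}$, and that $f$ is a nc function. Then there exist a nc set $\tilde\Omega\subseteq\mathcal{V}_{\rm nc}$ with $\tilde\Omega\supseteq\Omega$ and $\operatorname{supp}\tilde\Omega=\mathbb{N}d$,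 and a nc function $\tilde f\colon\tilde\Omega\to\tilde\Omega$ with $\tilde f|_\Omega=f$, such that for every $n\in\mathbb{N}d$: (a) $\tilde f|_{\tilde\Omega_n}$ has a unique fixed point, namely $X_{*n}=\bigoplus_{\alpha=1}^{n/d}X_*$; (b) $\tilde\Omega_n$ is a complete metric space with respect to the metric $\tilde\rho_n(X,Y)=\|X-Y\|_n$, $X,Y\in\tilde\Omega_n$ (which extends the metric $\rho_n$ if $n\in\operatorname{supp}\Omega$); (c) there exists $\tilde c_n$ with $0\le\tilde c_n<1$ (and $\tilde c_n\ge c_n$ if $n\in\operatorname{supp}\Omega$) such that $\|\tilde f(X)-\tilde f(X_{*n})\|_n\le\tilde c_n\|X-X_{*n}\|_n$ for all $X\in\tilde\Omega_n$; (d) for an arbitrary $X^0\in\tilde\Omega_n$, the sequence defined by $X^{j+1}=\tilde f(X^j)$, $j=0,1,\ldots$, satisfies $X_{*n}=\lim_{j\to\infty}X^j$ and, moreover, $\|X^j-X_{*n}\|_n\le(\tilde c_n)^j\|X^0-X_{*n}\|_n$ for $j=1,2,\ldots$, with $\tilde c_n$ as in (c).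
   Context: For a set $\mathcal{S}$, $\mathcal{S}^{n\times n}$ is the set of $n\times n$ matrices (arrays) with entries in $\mathcal{S}$, with no algebraic structure assumed, and $\mathcal{S}_{\rm nc}:=\coprod_{n=1}^\infty\mathcal{S}^{n\times n}$. For $\Omega\subseteq\mathcal{S}_{\rm nc}$ write $\Omega_n:=\Omega\cap\mathcal{S}^{n\times n}$ and $\operatorname{supp}\Omega:=\{n\in\mathbb{N}\colon\Omega_n\neq\emptyset\}$, where $\mathbb{N}=\{1,2,\dots\}$. $\mathbb{N}d=\{d,2d,3d,\dots\}$. With a fixed element $O\in\mathcal{S}$, the direct sum of $X\in\mathcal{S}^{n\times n}$ and $Y\in\mathcal{S}^{m\times m}$ is the block matrix $X\oplus Y:=\begin{bmatrix}X&\mathbf{O}_{n\times m}\\ \mathbf{O}_{m\times n}&Y\end{bmatrix}\in\mathcal{S}^{(n+m)\times(n+m)}$, where $\mathbf{O}_{p\times q}$ is the $p\times q$ matrix all of whose entries equal $O$. $\bigoplus_{\alpha=1}^kX$ is the direct sum of $k$ copies of $X$. $\Omega$ is closed under (respects) direct sums if $X\in\Omega_n$, $Y\in\Omega_m$ imply $X\oplus Y\in\Omega_{n+m}$. A vector space $\mathcal{V}$ over $\mathbb{F}$ ($\mathbb{F}=\mathbb{C}$ or $\mathbb{R}$) is an operator space if Banach space norms $\|\cdot\|_n$ on $\mathcal{V}^{n\times n}$, $n=1,2,\ldots$, are given such that $\|X\oplus Y\|_{n+m}=\max\{\|X\|_n,\|Y\|_m\}$ for all $X\in\mathcal{V}^{n\times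 n}$, $Y\in\mathcal{V}^{m\times m}$, and $\|SXT\|_n\le\|S\|\,\|X\|_n\|T\|$ for all $X\in\mathcal{V}^{n\times n}$, $S,T\in\mathbb{F}^{n\times n}$, where $\|\cdot\|$ is the $(2,2)$ operator norm on $\mathbb{F}^{n\times n}$. A subset of $\mathcal{V}_{\rm nc}$ closed under direct sums (with $O=0$) is called a nc set. For a nc set $\Omega\subseteq\mathcal{V}_{\rm nc}$, a mapping $f\colon\Omega\to\mathcal{V}_{\rm nc}$ with $f(\Omega_n)\subseteq\mathcal{V}^{n\times n}$ for all $n$ is a nc function if it respects direct sums ($f(X\oplus Y)=f(X)\oplus f(Y)$ for all $X,Y\in\Omega$) and respects similarities (if $X\in\Omega_n$ and $S\in\mathbb{F}^{n\times n}$ is invertible with $SXS^{-1}\in\Omega_n$, then $f(SXS^{-1})=Sf(X)S^{-1}$); matrices over $\mathbb{F}$ act on matrices over $\mathcal{V}$ by usual matrix multiplication. *)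

theory Defs
  imports
    "HOL-Analysis.Abstract_Metric_Spaces"
    "HOL-Analysis.L2_Norm"
    "Jordan_Normal_Form.Matrix"
begin

text \<open>
  A set \<open>S\<close> is rendered as a type. Matrices of all sizes are elements of the single type
  \<^typ>\<open>'a mat\<close>, which records the dimensions, so the disjoint union of the sets
  of \<open>n\<close> by \<open>n\<close> matrices, \<open>n \<ge> 1\<close>, is an ordinary union.
\<close>

definition nc_space :: "'a mat set" where
  "nc_space = (\<Union>n\<in>{1..}. carrier_mat n n)"

definition level :: "'a mat set \<Rightarrow> nat \<Rightarrow> 'a mat set" where
  "level \<Omega> n = \<Omega> \<inter> carrier_mat n n"

definition nc_supp :: "'a mat set \<Rightarrow> nat set" where
  "nc_supp \<Omega> = {n. n \<ge> 1 \<and> level \<Omega> n \<noteq> {}}"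

definition dsum :: "'a \<Rightarrow> 'a mat \<Rightarrow> 'a mat \<Rightarrow> 'a mat" where
  "dsum z X Y = four_block_mat X (mat (dim_row X) (dim_col Y) (\<lambda>_. z))
                               (mat (dim_row Y) (dim_col X) (\<lambda>_. z)) Y"

primrec dsum_copies :: "'a \<Rightarrow> nat \<Rightarrow> 'a mat \<Rightarrow> 'a mat" where
  "dsum_copies z 0 X = mat 0 0 (\<lambda>_. z)"
| "dsum_copies z (Suc k) X = dsum z X (dsum_copies z k X)"

lemma dsum_copies_1: "dsum_copies z 1 X = X"
  by (rule eq_matI) (auto simp: dsum_def)

definition closed_under_dsum :: "'a \<Rightarrow> 'a mat set \<Rightarrow> bool" where
  "closed_under_dsum z \<Omega> \<longleftrightarrow> (\<forall>X\<in>\<Omega>. \<forall>Y\<in>\<Omega>. dsum z X Y \<in> \<Omega>)"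

text \<open>
  The library locale \<^locale>\<open>Metric_space\<close> asks for nonnegativity and symmetry of the
  distance also outside of the carrier. Cutting the distance off there makes both
  properties a condition on the carrier only.
\<close>

definition dist_on :: "'b set \<Rightarrow> ('b \<Rightarrow> 'b \<Rightarrow> real) \<Rightarrow> 'b \<Rightarrow> 'b \<Rightarrow> real" where
  "dist_on M \<rho> = (\<lambda>x y. if x \<in> M \<and> y \<in> M then \<rho> x y else 0)"

definition complete_metric_on :: "'b set \<Rightarrow> ('b \<Rightarrow> 'b \<Rightarrow> real) \<Rightarrow> bool" where
  "complete_metric_on M \<rho> \<longleftrightarrow>
     Metric_space M (dist_on M \<rho>) \<and> Metric_space.mcomplete M (dist_on M \<rho>)"

locale nc_contraction =
  fixes z :: 'a
    and \<Omega> :: "'a mat set"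
    and \<rho> :: "nat \<Rightarrow> 'a mat \<Rightarrow> 'a mat \<Rightarrow> real"
    and f :: "'a mat \<Rightarrow> 'a mat"
    and c :: "nat \<Rightarrow> real"
  assumes subset: "\<Omega> \<subseteq> nc_space"
    and nonempty: "\<Omega> \<noteq> {}"
    and closed: "closed_under_dsum z \<Omega>"
    and complete: "\<And>n. n \<in> nc_supp \<Omega> \<Longrightarrow> complete_metric_on (level \<Omega> n) (\<rho> n)"
    and maps: "\<And>n. n \<in> nc_supp \<Omega> \<Longrightarrow> f ` level \<Omega> n \<subseteq> level \<Omega> n"
    and respects_dsum: "\<And>X Y. X \<in> \<Omega> \<Longrightarrow> Y \<in> \<Omega> \<Longrightarrow> f (dsum z X Y) = dsum z (f X) (f Y)"
    and const: "\<And>n. n \<in> nc_supp \<Omega> \<Longrightarrow> 0 \<le> c n \<and> c n < 1"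
    and contraction: "\<And>n X Y. n \<in> nc_supp \<Omega> \<Longrightarrow> X \<in> level \<Omega> n \<Longrightarrow> Y \<in> level \<Omega> n \<Longrightarrow>
                        \<rho> n (f X) (f Y) \<le> c n * \<rho> n X Y"

definition scal_mat_mult ::
  "('f \<Rightarrow> 'v \<Rightarrow> 'v) \<Rightarrow> 'f mat \<Rightarrow> 'v::comm_monoid_add mat \<Rightarrow> 'v mat" where
  "scal_mat_mult smul S X =
     mat (dim_row S) (dim_col X) (\<lambda>(i, j). \<Sum>k<dim_row X. smul (S $$ (i, k)) (X $$ (k, j)))"

definition mat_scal_mult ::
  "('f \<Rightarrow> 'v \<Rightarrow> 'v) \<Rightarrow> 'v::comm_monoid_add mat \<Rightarrow> 'f mat \<Rightarrow> 'v mat" where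
  "mat_scal_mult smul X T =
     mat (dim_row X) (dim_col T) (\<lambda>(i, j). \<Sum>k<dim_col X. smul (T $$ (k, j)) (X $$ (i, k)))"

definition vec_norm2 :: "'f::real_normed_field vec \<Rightarrow> real" where
  "vec_norm2 v = L2_set (\<lambda>i. norm (v $ i)) {..<dim_vec v}"

definition op_norm :: "'f::real_normed_field mat \<Rightarrow> real" where
  "op_norm S = (SUP v\<in>{v \<in> carrier_vec (dim_col S). vec_norm2 v \<le> 1}. vec_norm2 (S *\<^sub>v v))"

locale operator_space = vector_space smul
  for smul :: "'f::real_normed_field \<Rightarrow> 'v::ab_group_add \<Rightarrow> 'v" +
  fixes nrm :: "nat \<Rightarrow> 'v mat \<Rightarrow> real"
  assumes nrm_nonneg: "\<And>n X. n \<ge> 1 \<Longrightarrow> X \<in> carrier_mat n n \<Longrightarrow> 0 \<le> nrm n X"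
    and nrm_eq_0_iff: "\<And>n X. n \<ge> 1 \<Longrightarrow> X \<in> carrier_mat n n \<Longrightarrow> nrm n X = 0 \<longleftrightarrow> X = 0\<^sub>m n n"
    and nrm_scale: "\<And>n a X. n \<ge> 1 \<Longrightarrow> X \<in> carrier_mat n n \<Longrightarrow>
                      nrm n (map_mat (smul a) X) = norm a * nrm n X"
    and nrm_triangle: "\<And>n X Y. n \<ge> 1 \<Longrightarrow> X \<in> carrier_mat n n \<Longrightarrow> Y \<in> carrier_mat n n \<Longrightarrow>
                         nrm n (X + Y) \<le> nrm n X + nrm n Y"
    and nrm_complete: "\<And>n. n \<ge> 1 \<Longrightarrow>
                         complete_metric_on (carrier_mat n n) (\<lambda>X Y. nrm n (X - Y))"
    and nrm_dsum: "\<And>n m X Y. n \<ge> 1 \<Longrightarrow> m \<ge> 1 \<Longrightarrow>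
                     X \<in> carrier_mat n n \<Longrightarrow> Y \<in> carrier_mat m m \<Longrightarrow>
                     nrm (n + m) (dsum 0 X Y) = max (nrm n X) (nrm m Y)"
    and nrm_mult: "\<And>n S X T. n \<ge> 1 \<Longrightarrow>
                     S \<in> carrier_mat n n \<Longrightarrow> X \<in> carrier_mat n n \<Longrightarrow> T \<in> carrier_mat n n \<Longrightarrow>
                     nrm n (mat_scal_mult smul (scal_mat_mult smul S X) T)
                       \<le> op_norm S * nrm n X * op_norm T"

definition nc_set :: "'v::zero mat set \<Rightarrow> bool" where
  "nc_set \<Omega> \<longleftrightarrow> \<Omega> \<subseteq> nc_space \<and> closed_under_dsum 0 \<Omega>"

text \<open>In the last clause \<open>T\<close> is the inverse of \<open>S\<close>.\<close>

definition nc_function ::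
  "('f::field \<Rightarrow> 'v \<Rightarrow> 'v) \<Rightarrow> 'v::ab_group_add mat set \<Rightarrow> ('v mat \<Rightarrow> 'v mat) \<Rightarrow> bool" where
  "nc_function smul \<Omega> f \<longleftrightarrow>
     nc_set \<Omega> \<and>
     (\<forall>n. f ` level \<Omega> n \<subseteq> carrier_mat n n) \<and>
     (\<forall>X\<in>\<Omega>. \<forall>Y\<in>\<Omega>. f (dsum 0 X Y) = dsum 0 (f X) (f Y)) \<and>
     (\<forall>n. \<forall>X\<in>level \<Omega> n. \<forall>S\<in>carrier_mat n n. \<forall>T\<in>carrier_mat n n.
        inverts_mat S T \<longrightarrow> inverts_mat T S \<longrightarrow>
        mat_scal_mult smul (scal_mat_mult smul S X) T \<in> level \<Omega> n \<longrightarrow>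
        f (mat_scal_mult smul (scal_mat_mult smul S X) T) =
          mat_scal_mult smul (scal_mat_mult smul S (f X)) T)"

end

theory Submission
  imports Defs "HOL-Analysis.Urysohn" "Jordan_Normal_Form.Determinant"
begin

text \<open>
  By Banach's theorem every \<open>f\<close> restricted to \<open>\<Omega>\<^sub>n\<close> has a unique fixed point \<open>F n\<close>, and uniqueness
  forces \<open>F (n + m) = F n \<oplus> F m\<close>, so all the \<open>F n\<close> commute under direct sums. The support contains
  two elements \<open>b\<close> and \<open>b + d\<close>, and commutation of \<open>F b\<close> with \<open>F (b + d)\<close> yields a \<open>d\<close> by \<open>d\<close>
  block \<open>W\<close> with \<open>F (b + d) = F b \<oplus> W\<close>. Cancelling, \<open>W\<close> commutes with every \<open>F n\<close>, which is therefore
  a direct sum of copies of \<open>W\<close>.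

  For the second part, \<open>\<Omega>\<close> is enlarged to all finite direct sums of elements of \<open>\<Omega>\<close> and copies of
  \<open>W\<close>, and \<open>f\<close> acts summandwise, fixing \<open>W\<close>. Well-definedness and invariance under similarities are
  proved together: after adding sufficiently many copies of \<open>W\<close>, a block permutation carries the
  matrix into \<open>\<Omega>\<close>, where \<open>f\<close> respects similarities. At a fixed size only finitely many sizes of
  summands occur, and the norm of a direct sum is the maximum of the norms; this gives completeness
  and a uniform constant.
\<close>

subsection \<open>Direct sums as an equidivisible monoid\<close>

lemma dsum_carrier [simp]:
  "X \<in> carrier_mat n n \<Longrightarrow> Y \<in> carrier_mat m m \<Longrightarrow> dsum z X Y \<in> carrier_mat (n + m) (n + m)"
  by (auto simp: dsum_def)

lemma dsum_index:
  assumes "X \<in> carrier_mat n n" "Y \<in> carrier_mat m m" "i < n + m" "j < n + m"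
  shows "dsum z X Y $$ (i, j) =
    (if i < n then if j < n then X $$ (i, j) else z
     else if j < n then z else Y $$ (i - n, j - n))"
  using assms by (auto simp: dsum_def)

lemma dsum_dim [simp]:
  "dim_row (dsum z X Y) = dim_row X + dim_row Y" "dim_col (dsum z X Y) = dim_col X + dim_col Y"
  by (simp_all add: dsum_def)

text \<open>No shape is imposed on the matrices, so that this serves as an unconditional rewrite
  rule. The entry formula \<open>ix\<close> is therefore phrased with row and column dimensions
  separately.\<close>

lemma dsum_assoc: "dsum z (dsum z X Y) Z = dsum z X (dsum z Y Z)"
proof -
  have ix: "dsum z X Y $$ (i, j) =
    (if i < dim_row X then if j < dim_col X then X $$ (i, j) else z
     else if j < dim_col X then z else Y $$ (i - dim_row X, j - dim_col X))"
    if "i < dim_row X + dim_row Y" "j < dim_col X + dim_col Y" for X Y i j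
    using that by (simp add: dsum_def)
  show ?thesis
  proof (rule eq_matI)
    fix i j
    assume "i < dim_row (dsum z X (dsum z Y Z))" "j < dim_col (dsum z X (dsum z Y Z))"
    then show "dsum z (dsum z X Y) Z $$ (i, j) = dsum z X (dsum z Y Z) $$ (i, j)"
      by (cases "i < dim_row X"; cases "i < dim_row X + dim_row Y";
          cases "j < dim_col X"; cases "j < dim_col X + dim_col Y")
        (simp_all add: ix less_diff_conv2 add.commute)
  qed simp_all
qed

lemma dsum_empty_right: "X \<in> carrier_mat n n \<Longrightarrow> Y \<in> carrier_mat 0 0 \<Longrightarrow> dsum z X Y = X"
  by (rule eq_matI) (auto simp: dsum_def)

lemma dsum_empty_left: "X \<in> carrier_mat n n \<Longrightarrow> Y \<in> carrier_mat 0 0 \<Longrightarrow> dsum z Y X = X"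
  by (rule eq_matI) (auto simp: dsum_def)

text \<open>The analogue of Levi's lemma for words. The two decompositions cut the same matrix at
  \<open>n\<close> and at \<open>n + k\<close>, and \<open>W\<close> is the block between the cuts.
  The filler entries \<open>z\<close> required by each cut make the larger block of the other
  decomposition split.\<close>

lemma dsum_equidivisible:
  assumes X: "X \<in> carrier_mat n n" and Y: "Y \<in> carrier_mat (k + m) (k + m)"
    and X': "X' \<in> carrier_mat (n + k) (n + k)" and Y': "Y' \<in> carrier_mat m m"
    and eq: "dsum z X Y = dsum z X' Y'"
  obtains W where "W \<in> carrier_mat k k" "X' = dsum z X W" "Y = dsum z W Y'"
proof -
  define W where "W = mat k k (\<lambda>(i, j). Y $$ (i, j))"
  have W: "W \<in> carrier_mat k k" by (simp add: W_def)
  have W_ij: "W $$ (i, j) = Y $$ (i, j)" if "i < k" "j < k" for i j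
    using that by (simp add: W_def)
  have ij: "dsum z X Y $$ (i, j) = dsum z X' Y' $$ (i, j)" for i j by (simp add: eq)
  have X'W: "X' $$ (i, j) = dsum z X W $$ (i, j)" if "i < n + k" "j < n + k" for i j
    using ij[of i j] that
    by (auto simp: dsum_index[OF X Y] dsum_index[OF X W] dsum_index[OF X' Y'] W_ij split: if_splits)
  have YW: "Y $$ (i, j) = dsum z W Y' $$ (i, j)" if "i < k + m" "j < k + m" for i j
    using ij[of "n + i" "n + j"] that
    by (auto simp: dsum_index[OF X Y] dsum_index[OF W Y'] dsum_index[OF X' Y'] W_ij split: if_splits)
  show ?thesis
  proof (rule that[OF W])
    show "X' = dsum z X W"
      using X X' W by (intro eq_matI) (auto simp: X'W)
    show "Y = dsum z W Y'"
      using Y W Y' by (intro eq_matI) (auto simp: YW)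
  qed
qed

text \<open>The case of two coinciding cuts: the middle block has size 0 and disappears.\<close>

lemma dsum_cancel:
  assumes X: "X \<in> carrier_mat n n" "X' \<in> carrier_mat n n"
    and Y: "Y \<in> carrier_mat m m" "Y' \<in> carrier_mat m m"
    and eq: "dsum z X Y = dsum z X' Y'"
  shows "X = X'" "Y = Y'"
proof -
  obtain W where W: "W \<in> carrier_mat 0 0" "X' = dsum z X W" "Y = dsum z W Y'"
    by (rule dsum_equidivisible[of X n Y 0 m X' Y' z]) (simp_all add: assms)
  show "X = X'" using dsum_empty_right[OF X(1) W(1)] W(2) by metis
  show "Y = Y'" using dsum_empty_left[OF Y(2) W(1)] W(3) by metis
qed

lemma dsum_copies_carrier [simp]:
  "X \<in> carrier_mat d d \<Longrightarrow> dsum_copies z k X \<in> carrier_mat (k * d) (k * d)"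
  by (induction k) auto

lemma dsum_copies_add:
  assumes "X \<in> carrier_mat d d"
  shows "dsum_copies z (k + l) X = dsum z (dsum_copies z k X) (dsum_copies z l X)"
proof (induction k)
  case 0
  then show ?case
    using dsum_empty_left[OF dsum_copies_carrier[OF assms, of z l], of "mat 0 0 (\<lambda>_. z)" z] by simp
qed (simp add: dsum_assoc)

text \<open>As for commuting words, one letter is peeled off at a time. Equidivisibility applied to
  the commutation relation gives \<open>X = dsum z W V = dsum z V W\<close>, so the smaller
  remainder \<open>V\<close> commutes with \<open>W\<close> again.\<close>

lemma dsum_commute_imp_copies:
  assumes W: "W \<in> carrier_mat d d" and "X \<in> carrier_mat (k * d) (k * d)"
    and "dsum z W X = dsum z X W"
  shows "X = dsum_copies z k W"
  using assms(2,3)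
proof (induction k arbitrary: X)
  case 0
  from 0(1) show ?case by (intro eq_matI) auto
next
  case (Suc k)
  have "X \<in> carrier_mat (k * d + d) (k * d + d)" "X \<in> carrier_mat (d + k * d) (d + k * d)"
    using Suc.prems(1) by (simp_all add: add.commute)
  from dsum_equidivisible[OF W this W Suc.prems(2)]
  obtain V where V: "V \<in> carrier_mat (k * d) (k * d)" "X = dsum z W V" "X = dsum z V W" .
  have "V = dsum_copies z k W"
    using V(1) by (rule Suc.IH) (simp only: V(2)[symmetric] V(3)[symmetric])
  then show ?case by (simp only: V(2) dsum_copies.simps)
qed

text \<open>The least positive difference of two elements of an additive semigroup divides all
  its elements.\<close>

lemma semigroup_consecutive_multiples:
  fixes S :: "nat set"
  assumes "s \<in> S" "s \<ge> 1" and add: "\<And>a b. a \<in> S \<Longrightarrow> b \<in> S \<Longrightarrow> a + b \<in> S"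
  obtains b where "b \<in> S" "b + Gcd S \<in> S"
proof -
  define P where "P e \<longleftrightarrow> e \<ge> 1 \<and> (\<exists>b\<in>S. b + e \<in> S)" for e
  define e where "e = (LEAST e. P e)"
  have "P s" using assms by (auto simp: P_def)
  then have "P e" unfolding e_def by (rule LeastI)
  then obtain b where b: "e \<ge> 1" "b \<in> S" "b + e \<in> S" by (auto simp: P_def)
  have least: "e \<le> r" if "P r" for r unfolding e_def using that by (rule Least_le)
  have mult: "s + q * a \<in> S" if "s \<in> S" "a \<in> S" for s q a
  proof (induction q)
    case (Suc q)
    show ?case using add[OF Suc that(2)] by (simp add: algebra_simps)
  qed (simp add: that)
  have "e dvd n" if n: "n \<in> S" for n
  proof (rule ccontr)
    assume "\<not> e dvd n"
    then have r: "n mod e \<ge> 1" by (simp add: dvd_eq_mod_eq_0 Suc_le_eq)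
    let ?q = "n div e"
    \<comment> \<open>Both sums lie in \<open>S\<close>, so their difference \<open>n mod e\<close>
      is an admissible gap smaller than \<open>e\<close>. The leading \<open>n\<close> keeps
      \<open>n + ?q * (b + e)\<close> in \<open>S\<close> also when \<open>?q = 0\<close>.\<close>
    have "n + (n + ?q * b) = (n + ?q * (b + e)) + n mod e"
      by (simp add: algebra_simps)
    moreover have "n + (n + ?q * b) \<in> S" "n + ?q * (b + e) \<in> S"
      using mult b n add by auto
    ultimately have "P (n mod e)" unfolding P_def using r by metis
    then have "e \<le> n mod e" by (rule least)
    then show False using b(1) mod_less_divisor[of e n] by linarith
  qed
  then have "e dvd Gcd S" by (rule Gcd_greatest)
  moreover have "Gcd S dvd e"
    using b Gcd_dvd[of b S] Gcd_dvd[of "b + e" S] by (metis dvd_add_right_iff)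
  ultimately have "e = Gcd S" by (rule dvd_antisym)
  then show ?thesis using b that by blast
qed

subsection \<open>Fixed points are direct sums of one block\<close>

lemma (in nc_contraction) supp_of_mem:
  assumes "X \<in> \<Omega>"
  obtains n where "n \<in> nc_supp \<Omega>" "X \<in> level \<Omega> n" "n \<ge> 1"
proof -
  obtain n where "n \<ge> 1" "X \<in> carrier_mat n n"
    using assms subset by (auto simp: nc_space_def)
  then show ?thesis using assms that[of n] by (auto simp: nc_supp_def level_def)
qed

lemma (in nc_contraction) level_dsum:
  "X \<in> level \<Omega> n \<Longrightarrow> Y \<in> level \<Omega> m \<Longrightarrow> dsum z X Y \<in> level \<Omega> (n + m)"
  using closed by (auto simp: level_def closed_under_dsum_def)

lemma (in nc_contraction) supp_add:
  "n \<in> nc_supp \<Omega> \<Longrightarrow> m \<in> nc_supp \<Omega> \<Longrightarrow> n + m \<in> nc_supp \<Omega>"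
  using level_dsum[of _ n _ m] by (auto simp: nc_supp_def)

lemma (in nc_contraction) supp_consecutive:
  obtains b where "b \<in> nc_supp \<Omega>" "b + Gcd (nc_supp \<Omega>) \<in> nc_supp \<Omega>"
proof -
  obtain X where "X \<in> \<Omega>" using nonempty by blast
  then obtain s where "s \<in> nc_supp \<Omega>" "s \<ge> 1" using supp_of_mem by blast
  then show ?thesis using semigroup_consecutive_multiples[of s "nc_supp \<Omega>"] supp_add that by blast
qed

lemma (in nc_contraction) unique_fixed_point:
  assumes n: "n \<in> nc_supp \<Omega>"
  shows "\<exists>!X. X \<in> level \<Omega> n \<and> f X = X"
proof -
  interpret M: Metric_space "level \<Omega> n" "dist_on (level \<Omega> n) (\<rho> n)"
    using complete[OF n] by (simp add: complete_metric_on_def)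
  have dist: "dist_on (level \<Omega> n) (\<rho> n) (f X) (f Y) \<le> c n * dist_on (level \<Omega> n) (\<rho> n) X Y"
    if "X \<in> level \<Omega> n" "Y \<in> level \<Omega> n" for X Y
    using contraction[OF n that] maps[OF n] that by (auto simp: dist_on_def)
  obtain X where "X \<in> level \<Omega> n" "f X = X"
  proof (rule M.Banach_fixedpoint_thm)
    show "M.mcomplete" using complete[OF n] by (simp add: complete_metric_on_def)
    show "level \<Omega> n \<noteq> {}" using n by (simp add: nc_supp_def)
    show "f \<in> level \<Omega> n \<rightarrow> level \<Omega> n" using maps[OF n] by auto
    show "c n < 1" using const[OF n] by simp
    show "dist_on (level \<Omega> n) (\<rho> n) (f X) (f Y) \<le> c n * dist_on (level \<Omega> n) (\<rho> n) X Y"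
      if "X \<in> level \<Omega> n" "Y \<in> level \<Omega> n" for X Y
      using that by (rule dist)
  qed
  moreover have "X = Y" if XY: "X \<in> level \<Omega> n" "f X = X" "Y \<in> level \<Omega> n" "f Y = Y" for X Y
  proof (rule ccontr)
    assume "X \<noteq> Y"
    then have "dist_on (level \<Omega> n) (\<rho> n) X Y > 0" using XY by simp
    moreover have "c n < 1" using const[OF n] by simp
    ultimately have "c n * dist_on (level \<Omega> n) (\<rho> n) X Y < 1 * dist_on (level \<Omega> n) (\<rho> n) X Y"
      by (intro mult_strict_right_mono)
    then show False using dist[of X Y] XY by simp
  qed
  ultimately show ?thesis by blast
qed

lemma (in nc_contraction) fixed_points_copies:
  defines "d \<equiv> Gcd (nc_supp \<Omega>)"
  shows "\<exists>W\<in>carrier_mat d d. \<forall>n\<in>nc_supp \<Omega>.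
    {X \<in> level \<Omega> n. f X = X} = {dsum_copies z (n div d) W}"
proof -
  define F where "F n = (THE X. X \<in> level \<Omega> n \<and> f X = X)" for n
  have F: "F n \<in> level \<Omega> n \<and> f (F n) = F n" if "n \<in> nc_supp \<Omega>" for n
    unfolding F_def using unique_fixed_point[OF that] by (rule theI')
  have F_eq: "X = F n" if "n \<in> nc_supp \<Omega>" "X \<in> level \<Omega> n" "f X = X" for n X
    using unique_fixed_point[OF that(1)] F that by blast
  have F_carr: "F n \<in> carrier_mat n n" if "n \<in> nc_supp \<Omega>" for n
    using F[OF that] by (simp add: level_def)
  \<comment> \<open>A direct sum of fixed points is a fixed point of the larger size, where there is
    only one.\<close>
  have F_add: "dsum z (F n) (F m) = F (n + m)" if "n \<in> nc_supp \<Omega>" "m \<in> nc_supp \<Omega>" for n m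
  proof (rule F_eq)
    show "f (dsum z (F n) (F m)) = dsum z (F n) (F m)"
      using F that respects_dsum by (simp add: level_def)
  qed (use F that supp_add level_dsum in auto)
  obtain b where b: "b \<in> nc_supp \<Omega>" "b + d \<in> nc_supp \<Omega>"
    unfolding d_def by (rule supp_consecutive)
  have comm: "dsum z (F b) (F (b + d)) = dsum z (F (b + d)) (F b)"
    by (simp only: F_add[OF b] F_add[OF b(2) b(1)] add.commute)
  \<comment> \<open>The commutation relation cuts a matrix of size \<open>b + d + b\<close> at
    \<open>b\<close> and at \<open>b + d\<close>; the block between the cuts has size
    \<open>d\<close>. The two forms of the size match the two decompositions.\<close>
  have "F (b + d) \<in> carrier_mat (d + b) (d + b)" "F (b + d) \<in> carrier_mat (b + d) (b + d)"
    using F_carr[OF b(2)] by (simp_all add: add.commute)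
  from dsum_equidivisible[OF F_carr[OF b(1)] this F_carr[OF b(1)] comm]
  obtain W where W: "W \<in> carrier_mat d d" and FW: "F (b + d) = dsum z (F b) W" by metis
  have "F n = dsum_copies z (n div d) W" if n: "n \<in> nc_supp \<Omega>" for n
  proof (rule dsum_commute_imp_copies[OF W])
    have "d dvd n" unfolding d_def using n by (rule Gcd_dvd)
    then show "F n \<in> carrier_mat (n div d * d) (n div d * d)" using F_carr[OF n] by simp
    \<comment> \<open>Since \<open>d\<close> may lie outside the support, \<open>W\<close> need not
      be one of the \<open>F n\<close>. A prefix \<open>F b\<close> absorbs \<open>W\<close> into
      \<open>F (b + d)\<close>, whose commutation with \<open>F n\<close> is known; afterwards the
      prefix is cancelled.\<close>
    have "dsum z (F b) (dsum z (F n) W) = dsum z (F (b + n)) W"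
      by (simp only: dsum_assoc[symmetric] F_add[OF b(1) n])
    also have "\<dots> = dsum z (F n) (F (b + d))"
      by (simp only: add.commute[of b n] F_add[OF n b(1), symmetric] dsum_assoc FW)
    also have "\<dots> = dsum z (F (b + d)) (F n)"
      by (simp only: F_add[OF n b(2)] F_add[OF b(2) n] add.commute)
    also have "\<dots> = dsum z (F b) (dsum z W (F n))"
      by (simp only: FW dsum_assoc)
    finally have eq: "dsum z (F b) (dsum z (F n) W) = dsum z (F b) (dsum z W (F n))" .
    have "dsum z (F n) W \<in> carrier_mat (n + d) (n + d)" "dsum z W (F n) \<in> carrier_mat (n + d) (n + d)"
      using dsum_carrier[OF W F_carr[OF n], of z] dsum_carrier[OF F_carr[OF n] W, of z]
      by (simp_all add: add.commute)
    then show "dsum z W (F n) = dsum z (F n) W"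
      by (intro dsum_cancel(2)[OF F_carr[OF b(1)] F_carr[OF b(1)] _ _ eq, symmetric])
  qed
  then have "{X \<in> level \<Omega> n. f X = X} = {dsum_copies z (n div d) W}" if "n \<in> nc_supp \<Omega>" for n
    using F[OF that] F_eq[OF that] that by auto
  then show ?thesis using W by blast
qed

subsection \<open>Simultaneous similarity\<close>

text \<open>The inverse is passed as a separate argument \<open>T\<close>, as in
  \<open>nc_function\<close>; that \<open>S\<close> and \<open>T\<close> are mutually inverse is
  assumed where it matters.\<close>

definition mat_conj :: "('f \<Rightarrow> 'v \<Rightarrow> 'v) \<Rightarrow> 'f mat \<Rightarrow> 'f mat \<Rightarrow> 'v::comm_monoid_add mat \<Rightarrow> 'v mat" where
  "mat_conj smul S T X = mat_scal_mult smul (scal_mat_mult smul S X) T"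

lemma scal_mat_mult_carrier [simp]:
  "S \<in> carrier_mat n m \<Longrightarrow> X \<in> carrier_mat m k \<Longrightarrow> scal_mat_mult smul S X \<in> carrier_mat n k"
  by (auto simp: scal_mat_mult_def)

lemma mat_scal_mult_carrier [simp]:
  "X \<in> carrier_mat n m \<Longrightarrow> T \<in> carrier_mat m k \<Longrightarrow> mat_scal_mult smul X T \<in> carrier_mat n k"
  by (auto simp: mat_scal_mult_def)

lemma mat_conj_carrier [simp]:
  "S \<in> carrier_mat n n \<Longrightarrow> T \<in> carrier_mat n n \<Longrightarrow> X \<in> carrier_mat n n \<Longrightarrow>
    mat_conj smul S T X \<in> carrier_mat n n"
  unfolding mat_conj_def by (intro mat_scal_mult_carrier scal_mat_mult_carrier)

lemma scal_mat_mult_index: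
  "S \<in> carrier_mat n m \<Longrightarrow> X \<in> carrier_mat m k \<Longrightarrow> i < n \<Longrightarrow> j < k \<Longrightarrow>
    scal_mat_mult smul S X $$ (i, j) = (\<Sum>l<m. smul (S $$ (i, l)) (X $$ (l, j)))"
  by (auto simp: scal_mat_mult_def)

lemma mat_scal_mult_index:
  "X \<in> carrier_mat n m \<Longrightarrow> T \<in> carrier_mat m k \<Longrightarrow> i < n \<Longrightarrow> j < k \<Longrightarrow>
    mat_scal_mult smul X T $$ (i, j) = (\<Sum>l<m. smul (T $$ (l, j)) (X $$ (i, l)))"
  by (auto simp: mat_scal_mult_def)

lemma mult_mat_index:
  "A \<in> carrier_mat n m \<Longrightarrow> B \<in> carrier_mat m k \<Longrightarrow> i < n \<Longrightarrow> j < k \<Longrightarrow>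
    (A * B) $$ (i, j) = (\<Sum>l<m. A $$ (i, l) * B $$ (l, j))"
  by (auto simp: times_mat_def scalar_prod_def lessThan_atLeast0)

lemma sum_lessThan_add:
  fixes g :: "nat \<Rightarrow> 'b::comm_monoid_add"
  shows "(\<Sum>l<n + m. g l) = (\<Sum>l<n. g l) + (\<Sum>l<m. g (n + l))"
  by (induction m) (simp_all add: add.assoc)

lemma dsum_mult:
  fixes A :: "'f::semiring_0 mat"
  assumes "A \<in> carrier_mat n n" "A' \<in> carrier_mat n n" "B \<in> carrier_mat m m" "B' \<in> carrier_mat m m"
  shows "dsum 0 A B * dsum 0 A' B' = dsum 0 (A * A') (B * B')"
proof (rule eq_matI)
  fix i j
  assume "i < dim_row (dsum 0 (A * A') (B * B'))" "j < dim_col (dsum 0 (A * A') (B * B'))"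
  then have "i < n + m" "j < n + m" using assms by auto
  then show "(dsum 0 A B * dsum 0 A' B') $$ (i, j) = dsum 0 (A * A') (B * B') $$ (i, j)"
    using assms
    by (simp add: mult_mat_index[where n = "n + m" and m = "n + m" and k = "n + m"]
      mult_mat_index[where n = n and m = n and k = n] mult_mat_index[where n = m and m = m and k = m]
      dsum_index[where n = n and m = m] sum_lessThan_add mult_carrier_mat[of _ n n _ n]
      mult_carrier_mat[of _ m m _ m] del: index_mult_mat(1))
qed (use assms in auto)

lemma dsum_one: "dsum 0 (1\<^sub>m n) (1\<^sub>m m) = 1\<^sub>m (n + m)"
  by (rule eq_matI) (auto simp: dsum_index[of _ n _ m])

text \<open>A pair stands for an argument and the value assigned to it. One and the same
  \<open>S\<close> has to conjugate both components, so for pairs on the graph of a function this is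
  the way in which a nc function must transform.\<close>

definition simul_similar :: "('f::semiring_1 \<Rightarrow> 'v \<Rightarrow> 'v) \<Rightarrow> nat \<Rightarrow> 'v::comm_monoid_add mat \<times> 'v mat \<Rightarrow> 'v mat \<times> 'v mat \<Rightarrow> bool" where
  "simul_similar smul n p q \<longleftrightarrow>
    {fst p, snd p, fst q, snd q} \<subseteq> carrier_mat n n \<and>
    (\<exists>S\<in>carrier_mat n n. \<exists>T\<in>carrier_mat n n. S * T = 1\<^sub>m n \<and> T * S = 1\<^sub>m n \<and>
      fst q = mat_conj smul S T (fst p) \<and> snd q = mat_conj smul S T (snd p))"

section \<open>Matrix actions of the scalars and conjugation\<close>

context vector_space
begin

lemma scal_mat_mult_assoc:
  assumes S: "S \<in> carrier_mat n n" and T: "T \<in> carrier_mat n n" and X: "X \<in> carrier_mat n n"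
  shows "scal_mat_mult scale S (scal_mat_mult scale T X) = scal_mat_mult scale (S * T) X"
proof (rule eq_matI)
  fix i j assume "i < dim_row (scal_mat_mult scale (S * T) X)" "j < dim_col (scal_mat_mult scale (S * T) X)"
  then have ij: "i < n" "j < n" using S X by (auto simp: scal_mat_mult_def)
  have "scal_mat_mult scale S (scal_mat_mult scale T X) $$ (i, j)
    = (\<Sum>l<n. \<Sum>k<n. scale (S $$ (i, l) * T $$ (l, k)) (X $$ (k, j)))"
    using S T X ij by (simp add: scal_mat_mult_index[where n = n and m = n and k = n] scale_sum_right)
  also have "\<dots> = (\<Sum>k<n. \<Sum>l<n. scale (S $$ (i, l) * T $$ (l, k)) (X $$ (k, j)))"
    by (rule sum.swap)
  also have "\<dots> = scal_mat_mult scale (S * T) X $$ (i, j)"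
    using S T X ij mult_carrier_mat[OF S T]
    by (simp add: scal_mat_mult_index[where n = n and m = n and k = n]
        mult_mat_index[where n = n and m = n and k = n] scale_sum_left del: index_mult_mat)
  finally show "scal_mat_mult scale S (scal_mat_mult scale T X) $$ (i, j)
    = scal_mat_mult scale (S * T) X $$ (i, j)" .
qed (use S T X in \<open>auto simp: scal_mat_mult_def\<close>)

text \<open>Scalars of a right factor still act on vectors from the left, which reverses their
  order; commutativity of the field restores it.\<close>

lemma mat_scal_mult_assoc:
  assumes S: "S \<in> carrier_mat n n" and T: "T \<in> carrier_mat n n" and X: "X \<in> carrier_mat n n"
  shows "mat_scal_mult scale (mat_scal_mult scale X S) T = mat_scal_mult scale X (S * T)"
proof (rule eq_matI)
  fix i j assume "i < dim_row (mat_scal_mult scale X (S * T))" "j < dim_col (mat_scal_mult scale X (S * T))"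
  then have ij: "i < n" "j < n" using T X by (auto simp: mat_scal_mult_def)
  have "mat_scal_mult scale (mat_scal_mult scale X S) T $$ (i, j)
    = (\<Sum>l<n. \<Sum>k<n. scale (S $$ (k, l) * T $$ (l, j)) (X $$ (i, k)))"
    using S T X ij
    by (simp add: mat_scal_mult_index[where n = n and m = n and k = n] scale_sum_right mult.commute)
  also have "\<dots> = (\<Sum>k<n. \<Sum>l<n. scale (S $$ (k, l) * T $$ (l, j)) (X $$ (i, k)))"
    by (rule sum.swap)
  also have "\<dots> = mat_scal_mult scale X (S * T) $$ (i, j)"
    using S T X ij mult_carrier_mat[OF S T]
    by (simp add: mat_scal_mult_index[where n = n and m = n and k = n]
        mult_mat_index[where n = n and m = n and k = n] scale_sum_left del: index_mult_mat)
  finally show "mat_scal_mult scale (mat_scal_mult scale X S) T $$ (i, j)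
    = mat_scal_mult scale X (S * T) $$ (i, j)" .
qed (use S T X in \<open>auto simp: mat_scal_mult_def\<close>)

lemma scal_mat_scal_mult_assoc:
  assumes S: "S \<in> carrier_mat n n" and T: "T \<in> carrier_mat n n" and X: "X \<in> carrier_mat n n"
  shows "scal_mat_mult scale S (mat_scal_mult scale X T) = mat_scal_mult scale (scal_mat_mult scale S X) T"
proof (rule eq_matI)
  fix i j
  assume "i < dim_row (mat_scal_mult scale (scal_mat_mult scale S X) T)"
    "j < dim_col (mat_scal_mult scale (scal_mat_mult scale S X) T)"
  then have ij: "i < n" "j < n" using S T X by (auto simp: mat_scal_mult_def scal_mat_mult_def)
  have "scal_mat_mult scale S (mat_scal_mult scale X T) $$ (i, j)
    = (\<Sum>l<n. \<Sum>k<n. scale (S $$ (i, l) * T $$ (k, j)) (X $$ (l, k)))"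
    using S T X ij
    by (simp add: mat_scal_mult_index[where n = n and m = n and k = n]
        scal_mat_mult_index[where n = n and m = n and k = n] scale_sum_right)
  also have "\<dots> = (\<Sum>k<n. \<Sum>l<n. scale (S $$ (i, l) * T $$ (k, j)) (X $$ (l, k)))"
    by (rule sum.swap)
  also have "\<dots> = mat_scal_mult scale (scal_mat_mult scale S X) T $$ (i, j)"
    using S T X ij
    by (simp add: mat_scal_mult_index[where n = n and m = n and k = n]
        scal_mat_mult_index[where n = n and m = n and k = n] scale_sum_right mult.commute)
  finally show "scal_mat_mult scale S (mat_scal_mult scale X T) $$ (i, j)
    = mat_scal_mult scale (scal_mat_mult scale S X) T $$ (i, j)" .
qed (use S T X in \<open>auto simp: mat_scal_mult_def scal_mat_mult_def\<close>)

lemma mat_conj_mat_conj: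
  assumes "S \<in> carrier_mat n n" "T \<in> carrier_mat n n" "S' \<in> carrier_mat n n" "T' \<in> carrier_mat n n"
    "X \<in> carrier_mat n n"
  shows "mat_conj scale S T (mat_conj scale S' T' X) = mat_conj scale (S * S') (T' * T) X"
  using assms
  by (simp add: mat_conj_def scal_mat_mult_assoc[symmetric, of _ n] mat_scal_mult_assoc[symmetric, of _ n]
      scal_mat_scal_mult_assoc[of _ n])

lemma scal_mat_mult_one: "X \<in> carrier_mat n n \<Longrightarrow> scal_mat_mult scale (1\<^sub>m n) X = X"
  by (rule eq_matI)
    (auto simp: scal_mat_mult_def if_distrib[where f = "\<lambda>a. scale a _"] sum.delta' cong: if_cong)

lemma mat_scal_mult_one: "X \<in> carrier_mat n n \<Longrightarrow> mat_scal_mult scale X (1\<^sub>m n) = X"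
  by (rule eq_matI)
    (auto simp: mat_scal_mult_def if_distrib[where f = "\<lambda>a. scale a _"] sum.delta' cong: if_cong)

lemma mat_conj_one: "X \<in> carrier_mat n n \<Longrightarrow> mat_conj scale (1\<^sub>m n) (1\<^sub>m n) X = X"
  by (simp add: mat_conj_def scal_mat_mult_one mat_scal_mult_one)

lemma mat_conj_inverse:
  assumes "S \<in> carrier_mat n n" "T \<in> carrier_mat n n" "X \<in> carrier_mat n n" "T * S = 1\<^sub>m n"
  shows "mat_conj scale T S (mat_conj scale S T X) = X"
  using assms by (simp add: mat_conj_mat_conj[of _ n] mat_conj_one)

lemma scal_mat_mult_dsum:
  assumes "S \<in> carrier_mat n n" "S' \<in> carrier_mat m m" "X \<in> carrier_mat n n" "X' \<in> carrier_mat m m"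
  shows "scal_mat_mult scale (dsum 0 S S') (dsum 0 X X')
    = dsum 0 (scal_mat_mult scale S X) (scal_mat_mult scale S' X')"
proof (rule eq_matI)
  fix i j
  assume "i < dim_row (dsum 0 (scal_mat_mult scale S X) (scal_mat_mult scale S' X'))"
    "j < dim_col (dsum 0 (scal_mat_mult scale S X) (scal_mat_mult scale S' X'))"
  then have "i < n + m" "j < n + m" using assms by (auto simp: scal_mat_mult_def)
  then show "scal_mat_mult scale (dsum 0 S S') (dsum 0 X X') $$ (i, j)
    = dsum 0 (scal_mat_mult scale S X) (scal_mat_mult scale S' X') $$ (i, j)"
    using assms
    by (simp add: scal_mat_mult_index[where n = "n + m" and m = "n + m" and k = "n + m"]
      scal_mat_mult_index[where n = n and m = n and k = n]
      scal_mat_mult_index[where n = m and m = m and k = m]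
      dsum_index[where n = n and m = m] sum_lessThan_add)
qed (use assms in \<open>auto simp: scal_mat_mult_def\<close>)

lemma mat_scal_mult_dsum:
  assumes "T \<in> carrier_mat n n" "T' \<in> carrier_mat m m" "X \<in> carrier_mat n n" "X' \<in> carrier_mat m m"
  shows "mat_scal_mult scale (dsum 0 X X') (dsum 0 T T')
    = dsum 0 (mat_scal_mult scale X T) (mat_scal_mult scale X' T')"
proof (rule eq_matI)
  fix i j
  assume "i < dim_row (dsum 0 (mat_scal_mult scale X T) (mat_scal_mult scale X' T'))"
    "j < dim_col (dsum 0 (mat_scal_mult scale X T) (mat_scal_mult scale X' T'))"
  then have "i < n + m" "j < n + m" using assms by (auto simp: mat_scal_mult_def)
  then show "mat_scal_mult scale (dsum 0 X X') (dsum 0 T T') $$ (i, j)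
    = dsum 0 (mat_scal_mult scale X T) (mat_scal_mult scale X' T') $$ (i, j)"
    using assms
    by (simp add: mat_scal_mult_index[where n = "n + m" and m = "n + m" and k = "n + m"]
      mat_scal_mult_index[where n = n and m = n and k = n]
      mat_scal_mult_index[where n = m and m = m and k = m]
      dsum_index[where n = n and m = m] sum_lessThan_add)
qed (use assms in \<open>auto simp: mat_scal_mult_def\<close>)

lemma mat_conj_dsum:
  assumes "S \<in> carrier_mat n n" "T \<in> carrier_mat n n" "X \<in> carrier_mat n n"
    "S' \<in> carrier_mat m m" "T' \<in> carrier_mat m m" "X' \<in> carrier_mat m m"
  shows "mat_conj scale (dsum 0 S S') (dsum 0 T T') (dsum 0 X X')
    = dsum 0 (mat_conj scale S T X) (mat_conj scale S' T' X')"
  using assms by (simp add: mat_conj_def scal_mat_mult_dsum[of _ n _ m] mat_scal_mult_dsum[of _ n _ m])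

section \<open>Simultaneous similarity as an equivalence relation compatible with direct
  sums\<close>

lemma simul_similarI:
  assumes "X \<in> carrier_mat n n" "Z \<in> carrier_mat n n" "S \<in> carrier_mat n n" "T \<in> carrier_mat n n"
    "S * T = 1\<^sub>m n" "T * S = 1\<^sub>m n"
  shows "simul_similar scale n (X, Z) (mat_conj scale S T X, mat_conj scale S T Z)"
  using assms unfolding simul_similar_def by auto

lemma simul_similar_refl:
  "X \<in> carrier_mat n n \<Longrightarrow> Z \<in> carrier_mat n n \<Longrightarrow> simul_similar scale n (X, Z) (X, Z)"
  using simul_similarI[of X n Z "1\<^sub>m n" "1\<^sub>m n"] by (simp add: mat_conj_one)

lemma simul_similar_sym:
  assumes "simul_similar scale n p q"
  shows "simul_similar scale n q p"
proof -
  obtain S T where ST: "S \<in> carrier_mat n n" "T \<in> carrier_mat n n" "S * T = 1\<^sub>m n" "T * S = 1\<^sub>m n"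
    "fst q = mat_conj scale S T (fst p)" "snd q = mat_conj scale S T (snd p)"
    and c: "fst p \<in> carrier_mat n n" "snd p \<in> carrier_mat n n"
    using assms unfolding simul_similar_def by blast
  have "simul_similar scale n (fst q, snd q) (mat_conj scale T S (fst q), mat_conj scale T S (snd q))"
    using ST c by (intro simul_similarI) simp_all
  moreover have "mat_conj scale T S (fst q) = fst p" "mat_conj scale T S (snd q) = snd p"
    using ST c by (simp_all add: mat_conj_inverse[of _ n])
  ultimately show ?thesis by simp
qed

lemma simul_similar_trans:
  assumes "simul_similar scale n p q" "simul_similar scale n q r"
  shows "simul_similar scale n p r"
proof -
  obtain S T where ST: "S \<in> carrier_mat n n" "T \<in> carrier_mat n n" "S * T = 1\<^sub>m n" "T * S = 1\<^sub>m n"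
    "fst q = mat_conj scale S T (fst p)" "snd q = mat_conj scale S T (snd p)"
    and c: "fst p \<in> carrier_mat n n" "snd p \<in> carrier_mat n n"
    using assms(1) unfolding simul_similar_def by blast
  obtain S' T' where ST': "S' \<in> carrier_mat n n" "T' \<in> carrier_mat n n" "S' * T' = 1\<^sub>m n" "T' * S' = 1\<^sub>m n"
    "fst r = mat_conj scale S' T' (fst q)" "snd r = mat_conj scale S' T' (snd q)"
    using assms(2) unfolding simul_similar_def by blast
  have inv: "(A * B) * (C * D) = 1\<^sub>m n"
    if "A \<in> carrier_mat n n" "B \<in> carrier_mat n n" "C \<in> carrier_mat n n" "D \<in> carrier_mat n n"
      "B * C = 1\<^sub>m n" "A * D = 1\<^sub>m n" for A B C D :: "'a mat"
  proof -
    have "(A * B) * (C * D) = A * ((B * C) * D)"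
      using that(1-4) by (simp add: assoc_mult_mat[of _ n n _ n _ n])
    then show ?thesis using that by simp
  qed
  have "r = (mat_conj scale (S' * S) (T * T') (fst p), mat_conj scale (S' * S) (T * T') (snd p))"
    using ST ST' c by (intro prod_eqI) (simp_all add: mat_conj_mat_conj[of _ n])
  then show ?thesis
    using simul_similarI[of "fst p" n "snd p" "S' * S" "T * T'"] ST ST' c inv by simp
qed

lemma simul_similar_dsum:
  assumes "simul_similar scale n (X, Z) (Y, W)" "simul_similar scale m (X', Z') (Y', W')"
  shows "simul_similar scale (n + m) (dsum 0 X X', dsum 0 Z Z') (dsum 0 Y Y', dsum 0 W W')"
proof -
  obtain S T where ST: "S \<in> carrier_mat n n" "T \<in> carrier_mat n n" "S * T = 1\<^sub>m n" "T * S = 1\<^sub>m n"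
    "Y = mat_conj scale S T X" "W = mat_conj scale S T Z"
    and c: "X \<in> carrier_mat n n" "Z \<in> carrier_mat n n"
    using assms(1) unfolding simul_similar_def by auto
  obtain S' T' where ST': "S' \<in> carrier_mat m m" "T' \<in> carrier_mat m m" "S' * T' = 1\<^sub>m m" "T' * S' = 1\<^sub>m m"
    "Y' = mat_conj scale S' T' X'" "W' = mat_conj scale S' T' Z'"
    and c': "X' \<in> carrier_mat m m" "Z' \<in> carrier_mat m m"
    using assms(2) unfolding simul_similar_def by auto
  show ?thesis
    using simul_similarI[of "dsum 0 X X'" "n + m" "dsum 0 Z Z'" "dsum 0 S S'" "dsum 0 T T'"] ST ST' c c'
    by (simp add: mat_conj_dsum[of _ n _ _ _ m] dsum_mult[of _ n _ _ m] dsum_one)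
qed

text \<open>The conjugating matrix is a block permutation depending on the sizes alone, so the same
  one serves both components of the pair.\<close>

lemma simul_similar_swap:
  assumes X: "X \<in> carrier_mat n n" "Z \<in> carrier_mat n n" and Y: "Y \<in> carrier_mat m m" "W \<in> carrier_mat m m"
  shows "simul_similar scale (n + m) (dsum 0 X Y, dsum 0 Z W) (dsum 0 Y X, dsum 0 W Z)"
proof -
  \<comment> \<open>Row \<open>i\<close> of the swapped sum is row \<open>\<sigma> i\<close> of the
    original one: the first \<open>m\<close> rows come from the block that starts at
    \<open>n\<close>.\<close>
  define \<sigma> where "\<sigma> i = (if i < m then n + i else i - m)" for i
  define S :: "'a mat" where "S = mat (n + m) (n + m) (\<lambda>(i, k). if k = \<sigma> i then 1 else 0)"
  define T :: "'a mat" where "T = mat (n + m) (n + m) (\<lambda>(k, j). if k = \<sigma> j then 1 else 0)"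
  have \<sigma>: "\<sigma> i < n + m" if "i < n + m" for i using that by (auto simp: \<sigma>_def)
  have \<sigma>_inj: "\<sigma> i = \<sigma> j \<longleftrightarrow> i = j" if "i < n + m" "j < n + m" for i j
    using that by (auto simp: \<sigma>_def)
  have carr: "S \<in> carrier_mat (n + m) (n + m)" "T \<in> carrier_mat (n + m) (n + m)"
    by (simp_all add: S_def T_def)
  have S_ij: "S $$ (i, k) = (if k = \<sigma> i then 1 else 0)" "T $$ (k, i) = (if k = \<sigma> i then 1 else 0)"
    if "i < n + m" "k < n + m" for i k
    using that by (simp_all add: S_def T_def)
  have "S * T = 1\<^sub>m (n + m)"
    using carr \<sigma> \<sigma>_inj
    by (intro eq_matI) (auto simp: mult_mat_index[where n = "n + m" and m = "n + m" and k = "n + m"] S_ij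
        if_distrib[where f = "\<lambda>a. a * _"] sum.delta' sum.delta simp del: index_mult_mat(1) cong: if_cong)
  moreover from this have "T * S = 1\<^sub>m (n + m)"
    using mat_mult_left_right_inverse[OF carr] by simp
  moreover have "mat_conj scale S T (dsum 0 A B) = dsum 0 B A"
    if A: "A \<in> carrier_mat n n" and B: "B \<in> carrier_mat m m" for A B :: "'b mat"
  proof (rule eq_matI)
    let ?D = "dsum 0 A B"
    have D: "?D \<in> carrier_mat (n + m) (n + m)" using A B by simp
    have SD: "scal_mat_mult scale S ?D \<in> carrier_mat (n + m) (n + m)" using D carr by simp
    fix i j assume "i < dim_row (dsum 0 B A)" "j < dim_col (dsum 0 B A)"
    then have ij: "i < n + m" "j < n + m" using A B by auto
    have SD_ij: "scal_mat_mult scale S ?D $$ (i, l) = ?D $$ (\<sigma> i, l)" if "l < n + m" for l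
      using that ij \<sigma> by (simp add: scal_mat_mult_index[OF carr(1) D] S_ij
          if_distrib[where f = "\<lambda>a. scale a _"] sum.delta cong: if_cong)
    have "mat_conj scale S T ?D $$ (i, j) = ?D $$ (\<sigma> i, \<sigma> j)"
      using ij \<sigma> by (simp add: mat_conj_def mat_scal_mult_index[OF SD carr(2)] SD_ij S_ij
          if_distrib[where f = "\<lambda>a. scale a _"] sum.delta cong: if_cong)
    also have "\<dots> = dsum 0 B A $$ (i, j)"
      using ij \<sigma>[OF ij(1)] \<sigma>[OF ij(2)]
      by (auto simp: dsum_index[OF A B] dsum_index[OF B A] \<sigma>_def)
    finally show "mat_conj scale S T ?D $$ (i, j) = dsum 0 B A $$ (i, j)" .
  qed (use A B carr in \<open>auto simp: mat_conj_def scal_mat_mult_def mat_scal_mult_def\<close>)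
  ultimately show ?thesis
    using simul_similarI[of "dsum 0 X Y" "n + m" "dsum 0 Z W" S T] X Y carr by simp
qed

end

subsection \<open>Completeness\<close>

text \<open>For sequences and limits inside \<open>M\<close> the cut-off in \<open>dist_on\<close>
  has no effect, so completeness can be tested with \<open>\<rho>\<close> itself. The later
  arguments thereby become estimates of norms.\<close>

lemma complete_metric_on_iff:
  "complete_metric_on M \<rho> \<longleftrightarrow>
     Metric_space M (dist_on M \<rho>) \<and>
     (\<forall>\<sigma>. range \<sigma> \<subseteq> M \<longrightarrow> (\<forall>\<epsilon>>0. \<exists>N. \<forall>i\<ge>N. \<forall>j\<ge>N. \<rho> (\<sigma> i) (\<sigma> j) < \<epsilon>) \<longrightarrow>
       (\<exists>x\<in>M. (\<lambda>j. \<rho> (\<sigma> j) x) \<longlonglongrightarrow> 0))"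
proof (cases "Metric_space M (dist_on M \<rho>)")
  case True
  interpret Metric_space M "dist_on M \<rho>" by (rule True)
  have all_ge: "(\<forall>i j. N \<le> i \<longrightarrow> N \<le> j \<longrightarrow> Q i j) \<longleftrightarrow> (\<forall>i\<ge>N. \<forall>j\<ge>N. Q i j)"
    for N :: nat and Q by blast
  have cauchy: "MCauchy \<sigma> \<longleftrightarrow> (\<forall>\<epsilon>>0. \<exists>N. \<forall>i\<ge>N. \<forall>j\<ge>N. \<rho> (\<sigma> i) (\<sigma> j) < \<epsilon>)"
    if "range \<sigma> \<subseteq> M" for \<sigma>
  proof -
    have "dist_on M \<rho> (\<sigma> i) (\<sigma> j) = \<rho> (\<sigma> i) (\<sigma> j)" for i j
      using that by (auto simp: dist_on_def)
    then show ?thesis using that by (simp add: MCauchy_def all_ge)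
  qed
  have lim: "limitin mtopology \<sigma> x sequentially \<longleftrightarrow> x \<in> M \<and> (\<lambda>j. \<rho> (\<sigma> j) x) \<longlonglongrightarrow> 0"
    if "range \<sigma> \<subseteq> M" for \<sigma> x
  proof (cases "x \<in> M")
    case True
    then have "dist_on M \<rho> (\<sigma> j) x = \<rho> (\<sigma> j) x" for j
      using that by (auto simp: dist_on_def)
    then show ?thesis using that True by (auto simp: limitin_metric_dist_null range_subsetD)
  qed (simp add: limitin_metric_dist_null)
  have "mcomplete \<longleftrightarrow> (\<forall>\<sigma>. range \<sigma> \<subseteq> M \<longrightarrow> MCauchy \<sigma> \<longrightarrow> (\<exists>x. limitin mtopology \<sigma> x sequentially))"
    unfolding mcomplete_def by (auto simp: MCauchy_def)
  also have "\<dots> \<longleftrightarrow> (\<forall>\<sigma>. range \<sigma> \<subseteq> M \<longrightarrow> (\<forall>\<epsilon>>0. \<exists>N. \<forall>i\<ge>N. \<forall>j\<ge>N. \<rho> (\<sigma> i) (\<sigma> j) < \<epsilon>) \<longrightarrow>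
       (\<exists>x\<in>M. (\<lambda>j. \<rho> (\<sigma> j) x) \<longlonglongrightarrow> 0))"
    by (intro all_cong1 imp_cong refl) (simp_all add: cauchy lim Bex_def)
  finally show ?thesis using True by (simp add: complete_metric_on_def)
qed (simp add: complete_metric_on_def)

lemma Metric_space_dist_on_subset:
  assumes "Metric_space M (dist_on M \<rho>)" "A \<subseteq> M"
  shows "Metric_space A (dist_on A \<rho>)"
proof -
  interpret Metric_space M "dist_on M \<rho>" by (rule assms(1))
  have eq: "dist_on A \<rho> x y = (if x \<in> A \<and> y \<in> A then dist_on M \<rho> x y else 0)" for x y
    using assms(2) by (auto simp: dist_on_def)
  show ?thesis
    using assms(2) by unfold_locales (auto simp: eq commute subset_iff triangle)
qed

text \<open>A Cauchy sequence in the union visits \<open>A\<close> or \<open>B\<close> infinitely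
  often. The corresponding subsequence converges there, and a Cauchy sequence with a convergent
  subsequence converges.\<close>

lemma complete_metric_on_Un:
  assumes M: "Metric_space M (dist_on M \<rho>)" and AB: "A \<subseteq> M" "B \<subseteq> M"
    and A: "complete_metric_on A \<rho>" and B: "complete_metric_on B \<rho>"
  shows "complete_metric_on (A \<union> B) \<rho>"
proof -
  interpret U: Metric_space "A \<union> B" "dist_on (A \<union> B) \<rho>"
    using M AB by (intro Metric_space_dist_on_subset[OF M]) simp
  have conv: "\<exists>x. limitin U.mtopology \<sigma> x sequentially"
    if \<sigma>: "U.MCauchy \<sigma>" and C: "complete_metric_on C \<rho>" "C \<subseteq> A \<union> B" and inf: "infinite {j. \<sigma> j \<in> C}" for \<sigma> C
  proof -
    obtain r :: "nat \<Rightarrow> nat" where r: "strict_mono r" "\<forall>j. \<sigma> (r j) \<in> C"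
      using infinite_enumerate[OF inf] by auto
    have "U.MCauchy (\<sigma> \<circ> r)" using U.MCauchy_subsequence[OF r(1) \<sigma>] .
    moreover have "dist_on (A \<union> B) \<rho> (\<sigma> (r i)) (\<sigma> (r j)) = \<rho> (\<sigma> (r i)) (\<sigma> (r j))" for i j
      using r(2) C(2) by (auto simp: dist_on_def)
    ultimately have "\<forall>\<epsilon>>0. \<exists>N. \<forall>i\<ge>N. \<forall>j\<ge>N. \<rho> (\<sigma> (r i)) (\<sigma> (r j)) < \<epsilon>"
      unfolding U.MCauchy_def o_def by metis
    moreover have "range (\<lambda>j. \<sigma> (r j)) \<subseteq> C" using r(2) by auto
    ultimately obtain x where x: "x \<in> C" "(\<lambda>j. \<rho> (\<sigma> (r j)) x) \<longlonglongrightarrow> 0"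
      using C(1) unfolding complete_metric_on_iff by blast
    have "dist_on (A \<union> B) \<rho> (\<sigma> (r j)) x = \<rho> (\<sigma> (r j)) x" for j
      using r(2) x(1) C(2) by (auto simp: dist_on_def)
    then have "limitin U.mtopology (\<sigma> \<circ> r) x sequentially"
      using x r(2) C(2) by (auto simp: U.limitin_metric_dist_null subset_iff)
    then show ?thesis using U.MCauchy_convergent_subsequence[OF \<sigma> r(1)] by blast
  qed
  have "\<exists>x. limitin U.mtopology \<sigma> x sequentially" if \<sigma>: "U.MCauchy \<sigma>" for \<sigma>
  proof -
    have "{j. \<sigma> j \<in> A} \<union> {j. \<sigma> j \<in> B} = UNIV" using \<sigma> by (auto simp: U.MCauchy_def)
    then have "infinite {j. \<sigma> j \<in> A} \<or> infinite {j. \<sigma> j \<in> B}"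
      by (metis finite_Un infinite_UNIV_nat)
    then show ?thesis using conv[OF \<sigma> A] conv[OF \<sigma> B] by blast
  qed
  then show ?thesis
    using U.Metric_space_axioms by (simp add: complete_metric_on_def U.mcomplete_def)
qed

lemma complete_metric_on_empty: "complete_metric_on {} \<rho>"
  by (auto simp: complete_metric_on_iff dist_on_def Metric_space_def)

lemma complete_metric_on_finite_Union:
  assumes M: "Metric_space M (dist_on M \<rho>)" and "finite I"
    and "\<And>i. i \<in> I \<Longrightarrow> A i \<subseteq> M \<and> complete_metric_on (A i) \<rho>"
  shows "complete_metric_on (\<Union>i\<in>I. A i) \<rho>"
  using assms(2,3)
proof (induction I)
  case (insert i I)
  then have "complete_metric_on (A i \<union> (\<Union>i\<in>I. A i)) \<rho>"
    by (intro complete_metric_on_Un[OF M]) auto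
  then show ?case by simp
qed (simp add: complete_metric_on_empty)

lemma dsum_minus:
  fixes X :: "'v::group_add mat"
  assumes "X \<in> carrier_mat n n" "X' \<in> carrier_mat n n" "Y \<in> carrier_mat m m" "Y' \<in> carrier_mat m m"
  shows "dsum 0 X Y - dsum 0 X' Y' = dsum 0 (X - X') (Y - Y')"
  using assms
  by (intro eq_matI)
    (auto simp: dsum_index[where n = n and m = m] minus_carrier_mat[of _ n n] minus_carrier_mat[of _ m m])

section \<open>Direct sums in operator space norms\<close>

context operator_space
begin

lemma metric_space_nrm:
  "n \<ge> 1 \<Longrightarrow> Metric_space (carrier_mat n n) (dist_on (carrier_mat n n) (\<lambda>X Y. nrm n (X - Y)))"
  using nrm_complete by (simp add: complete_metric_on_def)

lemma nrm_self: "n \<ge> 1 \<Longrightarrow> X \<in> carrier_mat n n \<Longrightarrow> nrm n (X - X) = 0"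
  by (subst nrm_eq_0_iff) (auto intro: minus_carrier_mat)

lemma nrm_diff_eq_0:
  assumes "n \<ge> 1" "X \<in> carrier_mat n n" "Y \<in> carrier_mat n n" "nrm n (X - Y) = 0"
  shows "X = Y"
proof -
  interpret Metric_space "carrier_mat n n" "dist_on (carrier_mat n n) (\<lambda>X Y. nrm n (X - Y))"
    using assms by (intro metric_space_nrm)
  show ?thesis using zero[of X Y] assms by (simp add: dist_on_def)
qed

lemma nrm_dsum_diff:
  assumes "n \<ge> 1" "m \<ge> 1" "X \<in> carrier_mat n n" "X' \<in> carrier_mat n n"
    "Y \<in> carrier_mat m m" "Y' \<in> carrier_mat m m"
  shows "nrm (n + m) (dsum 0 X Y - dsum 0 X' Y') = max (nrm n (X - X')) (nrm m (Y - Y'))"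
  using assms
  by (simp add: dsum_minus[of _ n _ _ m] nrm_dsum[of n m] minus_carrier_mat[of _ n n] minus_carrier_mat[of _ m m])

text \<open>The norm of a difference of direct sums is the maximum of the norms of the two
  differences. Hence a Cauchy sequence of sums has Cauchy components, and the sum of their limits is
  its limit.\<close>

lemma complete_dsum_image:
  assumes p: "p \<ge> 1" "q \<ge> 1" and AB: "A \<subseteq> carrier_mat p p" "B \<subseteq> carrier_mat q q"
    and A: "complete_metric_on A (\<lambda>X Y. nrm p (X - Y))"
    and B: "complete_metric_on B (\<lambda>X Y. nrm q (X - Y))"
  shows "complete_metric_on ((\<lambda>(X, Y). dsum 0 X Y) ` (A \<times> B)) (\<lambda>X Y. nrm (p + q) (X - Y))"
    (is "complete_metric_on ?D _")
  unfolding complete_metric_on_iff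
proof (intro conjI allI impI)
  show "Metric_space ?D (dist_on ?D (\<lambda>X Y. nrm (p + q) (X - Y)))"
    using AB p
    by (intro Metric_space_dist_on_subset[OF metric_space_nrm]) (auto intro: dsum_carrier simp: subset_iff)
next
  fix \<sigma> :: "nat \<Rightarrow> 'v mat"
  assume "range \<sigma> \<subseteq> ?D" and
    cauchy: "\<forall>\<epsilon>>0. \<exists>N. \<forall>i\<ge>N. \<forall>j\<ge>N. nrm (p + q) (\<sigma> i - \<sigma> j) < \<epsilon>"
  then have "\<forall>j. \<exists>P. P \<in> A \<times> B \<and> \<sigma> j = dsum 0 (fst P) (snd P)" by fastforce
  then obtain P where P: "\<And>j. P j \<in> A \<times> B" "\<And>j. \<sigma> j = dsum 0 (fst (P j)) (snd (P j))" by metis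
  define X where "X j = fst (P j)" for j
  define Y where "Y j = snd (P j)" for j
  have XY: "X j \<in> A" "Y j \<in> B" "\<sigma> j = dsum 0 (X j) (Y j)" for j
    using P[of j] by (auto simp: X_def Y_def)
  have carr: "X j \<in> carrier_mat p p" "Y j \<in> carrier_mat q q" for j
    using XY[of j] AB by auto
  have nrm: "nrm (p + q) (\<sigma> i - dsum 0 X' Y') = max (nrm p (X i - X')) (nrm q (Y i - Y'))"
    if "X' \<in> carrier_mat p p" "Y' \<in> carrier_mat q q" for i X' Y'
    unfolding XY(3) using p carr that by (intro nrm_dsum_diff)
  have max: "nrm (p + q) (\<sigma> i - \<sigma> j) = max (nrm p (X i - X j)) (nrm q (Y i - Y j))" for i j
    using nrm[OF carr, of i j j] by (simp only: XY(3)[of j])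
  have "\<forall>\<epsilon>>0. \<exists>N. \<forall>i\<ge>N. \<forall>j\<ge>N. nrm p (X i - X j) < \<epsilon>"
    "\<forall>\<epsilon>>0. \<exists>N. \<forall>i\<ge>N. \<forall>j\<ge>N. nrm q (Y i - Y j) < \<epsilon>"
    using cauchy unfolding max max_less_iff_conj by meson+
  moreover have "range X \<subseteq> A" "range Y \<subseteq> B" using XY by auto
  ultimately obtain X' Y' where lim: "X' \<in> A" "(\<lambda>j. nrm p (X j - X')) \<longlonglongrightarrow> 0"
      "Y' \<in> B" "(\<lambda>j. nrm q (Y j - Y')) \<longlonglongrightarrow> 0"
    using A B unfolding complete_metric_on_iff by meson
  have "(\<lambda>j. max (nrm p (X j - X')) (nrm q (Y j - Y'))) \<longlonglongrightarrow> max 0 0"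
    by (intro tendsto_max lim)
  then have "(\<lambda>j. nrm (p + q) (\<sigma> j - dsum 0 X' Y')) \<longlonglongrightarrow> 0"
    using lim AB by (subst nrm) auto
  then show "\<exists>x\<in>?D. (\<lambda>j. nrm (p + q) (\<sigma> j - x)) \<longlonglongrightarrow> 0"
    using lim by auto
qed

lemma complete_singleton:
  assumes "n \<ge> 1" "X \<in> carrier_mat n n"
  shows "complete_metric_on {X} (\<lambda>X Y. nrm n (X - Y))"
  unfolding complete_metric_on_iff
proof (intro conjI allI impI)
  show "Metric_space {X} (dist_on {X} (\<lambda>X Y. nrm n (X - Y)))"
    using assms by (intro Metric_space_dist_on_subset[OF metric_space_nrm]) auto
next
  fix \<sigma> :: "nat \<Rightarrow> 'v mat"
  assume "range \<sigma> \<subseteq> {X}"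
  then have "\<sigma> j = X" for j by auto
  then show "\<exists>x\<in>{X}. (\<lambda>j. nrm n (\<sigma> j - x)) \<longlonglongrightarrow> 0"
    using nrm_self[OF assms] by simp
qed

end

subsection \<open>The extension\<close>

text \<open>The extension is built first as a relation, because a matrix can be decomposed into
  summands in several ways. Its domain is the enlarged set; that it is single-valued is proved
  later.\<close>

inductive_set dsum_graph :: "'v::zero mat set \<Rightarrow> ('v mat \<Rightarrow> 'v mat) \<Rightarrow> 'v mat \<Rightarrow> ('v mat \<times> 'v mat) set"
  for \<Omega> f W where
  mem: "A \<in> \<Omega> \<Longrightarrow> (A, f A) \<in> dsum_graph \<Omega> f W"
| star: "(W, W) \<in> dsum_graph \<Omega> f W"
| dsum: "(X, Z) \<in> dsum_graph \<Omega> f W \<Longrightarrow> (X', Z') \<in> dsum_graph \<Omega> f W \<Longrightarrow>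
    (dsum 0 X X', dsum 0 Z Z') \<in> dsum_graph \<Omega> f W"

text \<open>The setting of the second part, with \<open>W\<close> the block supplied by the first.
  The scalars form an arbitrary real normed field, so that both the real and the complex case are
  instances.\<close>

locale nc_fixed_point =
  operator_space smul nrm + nc_contraction 0 \<Omega> \<rho> f c
  for smul :: "'f::real_normed_field \<Rightarrow> 'v::ab_group_add \<Rightarrow> 'v"
    and nrm \<Omega> \<rho> f c +
  fixes W :: "'v mat" and d :: nat
  assumes d_def: "d = Gcd (nc_supp \<Omega>)"
    and rho: "\<And>n X Y. n \<in> nc_supp \<Omega> \<Longrightarrow> X \<in> level \<Omega> n \<Longrightarrow> Y \<in> level \<Omega> n \<Longrightarrow> \<rho> n X Y = nrm n (X - Y)"
    and nc_f: "nc_function smul \<Omega> f"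
    and W: "W \<in> carrier_mat d d"
    and fixed: "\<And>n. n \<in> nc_supp \<Omega> \<Longrightarrow> {X \<in> level \<Omega> n. f X = X} = {dsum_copies 0 (n div d) W}"
begin

abbreviation "star k \<equiv> dsum_copies 0 k W"
abbreviation "G \<equiv> dsum_graph \<Omega> f W"

lemma d_dvd: "n \<in> nc_supp \<Omega> \<Longrightarrow> d dvd n"
  unfolding d_def by (rule Gcd_dvd)

lemma d_pos: "d \<ge> 1"
proof -
  obtain X where "X \<in> \<Omega>" using nonempty by blast
  then obtain s where "s \<in> nc_supp \<Omega>" "s \<ge> 1" using supp_of_mem by blast
  then show ?thesis using d_dvd[of s] by (cases d) auto
qed

lemma star_carrier: "star k \<in> carrier_mat (k * d) (k * d)"
  using W by simp

lemma star_mem: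
  assumes "k * d \<in> nc_supp \<Omega>"
  shows "star k \<in> \<Omega>" "f (star k) = star k"
  using fixed[OF assms] d_pos by (auto simp: level_def)

lemma f_carrier:
  assumes "X \<in> \<Omega>" "X \<in> carrier_mat n n"
  shows "f X \<in> \<Omega>" "f X \<in> carrier_mat n n"
proof -
  obtain m where "m \<in> nc_supp \<Omega>" "X \<in> level \<Omega> m" using supp_of_mem assms by blast
  moreover from this have "m = n" using assms(2) by (auto simp: level_def)
  ultimately show "f X \<in> \<Omega>" "f X \<in> carrier_mat n n"
    using maps[of n] by (auto simp: level_def)
qed

lemma graph_carrier:
  assumes "(X, Z) \<in> G"
  obtains k where "k \<ge> 1" "X \<in> carrier_mat (k * d) (k * d)" "Z \<in> carrier_mat (k * d) (k * d)"
proof -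
  have "\<exists>k\<ge>1. X \<in> carrier_mat (k * d) (k * d) \<and> Z \<in> carrier_mat (k * d) (k * d)"
    using assms
  proof induction
    case (mem A)
    then obtain n where n: "n \<in> nc_supp \<Omega>" "A \<in> level \<Omega> n" "n \<ge> 1" using supp_of_mem by blast
    then obtain k where k: "n = k * d" using d_dvd by (metis dvd_def mult.commute)
    then have "k \<ge> 1" using n by (cases k) auto
    then show ?case using n k f_carrier[of A n] mem by (auto simp: level_def)
  next
    case star
    then show ?case using W by (intro exI[of _ 1]) simp
  next
    case (dsum X Z X' Z')
    then obtain k l where "k \<ge> 1" "X \<in> carrier_mat (k * d) (k * d)" "Z \<in> carrier_mat (k * d) (k * d)"
      "X' \<in> carrier_mat (l * d) (l * d)" "Z' \<in> carrier_mat (l * d) (l * d)"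
      by auto
    then show ?case by (intro exI[of _ "k + l"]) (simp add: add_mult_distrib)
  qed
  then show ?thesis using that by blast
qed

lemma graph_carrier_snd:
  assumes "(X, Z) \<in> G" "X \<in> carrier_mat n n"
  shows "Z \<in> carrier_mat n n"
  using graph_carrier[OF assms(1)] assms(2) by (metis carrier_matD(1))

lemma mult_supp:
  assumes "n \<in> nc_supp \<Omega>" "K \<ge> 1"
  shows "K * n \<in> nc_supp \<Omega>"
  using assms(2)
proof (induction K rule: dec_induct)
  case (step K)
  then show ?case using supp_add[OF assms(1) step.IH] by simp
qed (use assms in simp)

lemma star_add: "dsum 0 (star k) (star l) = star (k + l)"
  using W by (simp add: dsum_copies_add)

text \<open>Enlarging every summand \<open>W\<close> by \<open>N\<close> further copies turns it into a fixed point of \<open>f\<close> inside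
  \<open>\<Omega>\<close>; the added copies are moved next to it by block permutations.\<close>

lemma graph_simul_similar:
  assumes "(X, Z) \<in> G" and N: "N * d \<in> nc_supp \<Omega>" "Suc N * d \<in> nc_supp \<Omega>"
  shows "\<exists>K0. \<forall>K\<ge>K0. \<exists>Y\<in>\<Omega>. simul_similar smul (dim_row X + K * N * d)
    (dsum 0 X (star (K * N)), dsum 0 Z (star (K * N))) (Y, f Y)"
  using assms(1)
proof induction
  case (mem A)
  obtain n where n: "A \<in> carrier_mat n n" using mem supp_of_mem by (auto simp: level_def)
  show ?case
  proof (intro exI[of _ 1] allI impI)
    fix K :: nat assume "K \<ge> 1"
    then have "K * N * d \<in> nc_supp \<Omega>" using mult_supp[OF N(1), of K] by (simp add: mult.assoc)
    note s = star_mem[OF this]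
    have "dsum 0 A (star (K * N)) \<in> \<Omega>" using mem s closed by (auto simp: closed_under_dsum_def)
    moreover have "f (dsum 0 A (star (K * N))) = dsum 0 (f A) (star (K * N))"
      using respects_dsum[OF mem s(1)] s(2) by simp
    moreover have "simul_similar smul (n + K * N * d)
      (dsum 0 A (star (K * N)), dsum 0 (f A) (star (K * N)))
      (dsum 0 A (star (K * N)), dsum 0 (f A) (star (K * N)))"
      using n f_carrier[OF mem n] star_carrier by (intro simul_similar_refl dsum_carrier)
    ultimately show "\<exists>Y\<in>\<Omega>. simul_similar smul (dim_row A + K * N * d)
        (dsum 0 A (star (K * N)), dsum 0 (f A) (star (K * N))) (Y, f Y)"
      using n by (intro bexI[of _ "dsum 0 A (star (K * N))"]) auto
  qed
next
  case star
  show ?case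
  proof (intro exI[of _ 1] allI impI)
    fix K :: nat assume "K \<ge> 1"
    \<comment> \<open>The size is \<open>(K - 1) * (N * d) + Suc N * d\<close>, a sum of elements of
      the support. For \<open>K = 1\<close> the first term is 0 and lies outside the support, hence
      the case distinction.\<close>
    have "Suc (K * N) * d \<in> nc_supp \<Omega>"
    proof (cases "K = 1")
      case False
      then have "(K - 1) * (N * d) \<in> nc_supp \<Omega>" using \<open>K \<ge> 1\<close> by (intro mult_supp N) simp
      then have "(K - 1) * (N * d) + Suc N * d \<in> nc_supp \<Omega>" by (rule supp_add) (rule N)
      moreover have "(K - 1) * (N * d) + Suc N * d = Suc (K * N) * d"
        using \<open>K \<ge> 1\<close> by (cases K) (simp_all add: algebra_simps)
      ultimately show ?thesis by (simp only:)
    qed (use N in simp)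
    note s = star_mem[OF this]
    have "simul_similar smul (d + K * N * d) (star (Suc (K * N)), star (Suc (K * N)))
        (star (Suc (K * N)), f (star (Suc (K * N))))"
      using star_carrier[of "Suc (K * N)"] unfolding s(2) by (intro simul_similar_refl) simp_all
    then show "\<exists>Y\<in>\<Omega>. simul_similar smul (dim_row W + K * N * d)
        (dsum 0 W (star (K * N)), dsum 0 W (star (K * N))) (Y, f Y)"
      using s(1) W by (intro bexI[of _ "star (Suc (K * N))"]) auto
  qed
next
  case (dsum X Z X' Z')
  obtain n m where c: "X \<in> carrier_mat n n" "Z \<in> carrier_mat n n" "X' \<in> carrier_mat m m" "Z' \<in> carrier_mat m m"
    using graph_carrier[OF dsum.hyps(1)] graph_carrier[OF dsum.hyps(2)] by metis
  then have dims: "dim_row X = n" "dim_row X' = m" by auto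
  obtain K1 K2 where
    K1: "\<And>K. K \<ge> K1 \<Longrightarrow> \<exists>Y\<in>\<Omega>. simul_similar smul (n + K * N * d)
      (dsum 0 X (star (K * N)), dsum 0 Z (star (K * N))) (Y, f Y)" and
    K2: "\<And>K. K \<ge> K2 \<Longrightarrow> \<exists>Y\<in>\<Omega>. simul_similar smul (m + K * N * d)
      (dsum 0 X' (star (K * N)), dsum 0 Z' (star (K * N))) (Y, f Y)"
    using dsum.IH unfolding dims by blast
  show ?case
  proof (intro exI[of _ "K1 + K2"] allI impI)
    fix K assume K: "K \<ge> K1 + K2"
    \<comment> \<open>The padding is divided between the summands: \<open>K1 * N\<close> copies go
      to \<open>X\<close> and the remaining \<open>L * N\<close> to \<open>X'\<close>, enough for
      both induction hypotheses.\<close>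
    define L where "L = K - K1"
    have KL: "K = K1 + L" "L \<ge> K2" using K by (simp_all add: L_def)
    let ?s = "star (K1 * N)" and ?t = "star (L * N)"
    let ?a = "K1 * N * d" and ?b = "L * N * d"
    have s: "?s \<in> carrier_mat ?a ?a" and t: "?t \<in> carrier_mat ?b ?b" by (rule star_carrier)+
    have st: "star (K * N) = dsum 0 ?s ?t"
      by (simp add: star_add KL add_mult_distrib)
    obtain Y where Y: "Y \<in> \<Omega>" "simul_similar smul (n + ?a) (dsum 0 X ?s, dsum 0 Z ?s) (Y, f Y)"
      using K1[OF order_refl] by blast
    obtain Y' where Y': "Y' \<in> \<Omega>" "simul_similar smul (m + ?b) (dsum 0 X' ?t, dsum 0 Z' ?t) (Y', f Y')"
      using K2[OF KL(2)] by blast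
    \<comment> \<open>The padding follows \<open>X'\<close> as a whole; exchanging \<open>X'\<close>
      with the portion \<open>?s\<close> brings that portion next to \<open>X\<close>.\<close>
    have "simul_similar smul (n + ((m + ?a) + ?b))
      (dsum 0 X (dsum 0 (dsum 0 X' ?s) ?t), dsum 0 Z (dsum 0 (dsum 0 Z' ?s) ?t))
      (dsum 0 X (dsum 0 (dsum 0 ?s X') ?t), dsum 0 Z (dsum 0 (dsum 0 ?s Z') ?t))"
      using c s t by (intro simul_similar_dsum simul_similar_refl simul_similar_swap)
    then have "simul_similar smul ((n + ?a) + (m + ?b))
      (dsum 0 (dsum 0 X X') (star (K * N)), dsum 0 (dsum 0 Z Z') (star (K * N)))
      (dsum 0 (dsum 0 X ?s) (dsum 0 X' ?t), dsum 0 (dsum 0 Z ?s) (dsum 0 Z' ?t))"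
      unfolding st by (simp add: dsum_assoc ac_simps)
    moreover have "simul_similar smul ((n + ?a) + (m + ?b))
      (dsum 0 (dsum 0 X ?s) (dsum 0 X' ?t), dsum 0 (dsum 0 Z ?s) (dsum 0 Z' ?t))
      (dsum 0 Y Y', dsum 0 (f Y) (f Y'))"
      by (rule simul_similar_dsum[OF Y(2) Y'(2)])
    ultimately have "simul_similar smul ((n + ?a) + (m + ?b))
      (dsum 0 (dsum 0 X X') (star (K * N)), dsum 0 (dsum 0 Z Z') (star (K * N)))
      (dsum 0 Y Y', f (dsum 0 Y Y'))"
      unfolding respects_dsum[OF Y(1) Y'(1)] by (rule simul_similar_trans)
    moreover have "dsum 0 Y Y' \<in> \<Omega>" using Y Y' closed by (auto simp: closed_under_dsum_def)
    moreover have "(n + ?a) + (m + ?b) = dim_row (dsum 0 X X') + K * N * d"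
      using dims by (simp add: KL algebra_simps)
    ultimately show "\<exists>Y\<in>\<Omega>. simul_similar smul (dim_row (dsum 0 X X') + K * N * d)
        (dsum 0 (dsum 0 X X') (star (K * N)), dsum 0 (dsum 0 Z Z') (star (K * N))) (Y, f Y)"
      by metis
  qed
qed

lemma f_simul_similar:
  assumes "simul_similar smul n (Y, f Y) (Y', Z)" "Y \<in> \<Omega>" "Y' \<in> \<Omega>"
  shows "Z = f Y'"
proof -
  obtain S T where "S \<in> carrier_mat n n" "T \<in> carrier_mat n n" "S * T = 1\<^sub>m n" "T * S = 1\<^sub>m n"
    "Y' = mat_conj smul S T Y" "Z = mat_conj smul S T (f Y)" "Y \<in> carrier_mat n n" "Y' \<in> carrier_mat n n"
    using assms(1) unfolding simul_similar_def by auto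
  then show ?thesis
    using nc_f assms(2,3) unfolding nc_function_def
    by (auto simp: level_def inverts_mat_def mat_conj_def)
qed

text \<open>Equal arguments and the identity similarity give single-valuedness; the general case
  gives invariance under similarities. Both pairs are padded by the same number of copies of
  \<open>W\<close> and carried into \<open>\<Omega>\<close>, where \<open>f\<close> respects
  similarities; then the conjugation is undone and the padding cancelled.\<close>

lemma graph_similarity:
  assumes G: "(X, Z) \<in> G" "(X', Z') \<in> G" and XZ: "simul_similar smul n (X, Z) (X', Z'')"
  shows "Z' = Z''"
proof -
  have c: "X \<in> carrier_mat n n" "Z \<in> carrier_mat n n" "X' \<in> carrier_mat n n" "Z'' \<in> carrier_mat n n"
    using XZ by (auto simp: simul_similar_def)
  have Z': "Z' \<in> carrier_mat n n" using graph_carrier_snd[OF G(2) c(3)] .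
  obtain b where b: "b \<in> nc_supp \<Omega>" "b + d \<in> nc_supp \<Omega>"
    unfolding d_def by (rule supp_consecutive)
  define N where "N = b div d"
  have N: "N * d \<in> nc_supp \<Omega>" "Suc N * d \<in> nc_supp \<Omega>"
    using b d_dvd[OF b(1)] by (simp_all add: N_def add.commute)
  obtain K1 K2 where
    K1: "\<And>K. K \<ge> K1 \<Longrightarrow> \<exists>Y\<in>\<Omega>. simul_similar smul (dim_row X + K * N * d)
      (dsum 0 X (star (K * N)), dsum 0 Z (star (K * N))) (Y, f Y)" and
    K2: "\<And>K. K \<ge> K2 \<Longrightarrow> \<exists>Y\<in>\<Omega>. simul_similar smul (dim_row X' + K * N * d)
      (dsum 0 X' (star (K * N)), dsum 0 Z' (star (K * N))) (Y, f Y)"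
    using graph_simul_similar[OF G(1) N] graph_simul_similar[OF G(2) N] by blast
  define K where "K = max K1 K2"
  let ?m = "n + K * N * d" and ?s = "star (K * N)"
  have s: "?s \<in> carrier_mat (K * N * d) (K * N * d)" by (rule star_carrier)
  obtain Y where Y: "Y \<in> \<Omega>" "simul_similar smul ?m (dsum 0 X ?s, dsum 0 Z ?s) (Y, f Y)"
    using K1[of K] c by (auto simp: K_def)
  obtain Y' where Y': "Y' \<in> \<Omega>" "simul_similar smul ?m (dsum 0 X' ?s, dsum 0 Z' ?s) (Y', f Y')"
    using K2[of K] c by (auto simp: K_def)
  obtain S T where ST: "S \<in> carrier_mat ?m ?m" "T \<in> carrier_mat ?m ?m" "S * T = 1\<^sub>m ?m" "T * S = 1\<^sub>m ?m"
    "Y' = mat_conj smul S T (dsum 0 X' ?s)" "f Y' = mat_conj smul S T (dsum 0 Z' ?s)"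
    using Y'(2) unfolding simul_similar_def by auto
  \<comment> \<open>The chain runs from \<open>Y\<close> through the padded \<open>X\<close> and the
    padded \<open>X'\<close> to \<open>Y'\<close>. It ends with \<open>Z''\<close> in the second
    component where the graph has \<open>Z'\<close>, and \<open>f Y'\<close> is the conjugate of
    both padded matrices.\<close>
  have "simul_similar smul ?m (dsum 0 X ?s, dsum 0 Z ?s) (dsum 0 X' ?s, dsum 0 Z'' ?s)"
    using XZ s by (intro simul_similar_dsum simul_similar_refl)
  moreover have "simul_similar smul ?m (dsum 0 X' ?s, dsum 0 Z'' ?s)
      (Y', mat_conj smul S T (dsum 0 Z'' ?s))"
    unfolding ST(5) using ST(1-4) c s by (intro simul_similarI dsum_carrier)
  ultimately have "simul_similar smul ?m (Y, f Y) (Y', mat_conj smul S T (dsum 0 Z'' ?s))"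
    using simul_similar_sym[OF Y(2)] simul_similar_trans by blast
  then have "mat_conj smul S T (dsum 0 Z'' ?s) = mat_conj smul S T (dsum 0 Z' ?s)"
    using f_simul_similar Y(1) Y'(1) ST(6) by metis
  then have "mat_conj smul T S (mat_conj smul S T (dsum 0 Z'' ?s))
    = mat_conj smul T S (mat_conj smul S T (dsum 0 Z' ?s))" by simp
  then have "dsum 0 Z'' ?s = dsum 0 Z' ?s"
    using ST(1,2,4) dsum_carrier[OF c(4) s, of 0] dsum_carrier[OF Z' s, of 0]
    by (simp add: mat_conj_inverse[of _ ?m])
  then show ?thesis using dsum_cancel(1)[OF c(4) Z' s s] by metis
qed

section \<open>The extended nc function and its domain\<close>

definition ext :: "'v mat \<Rightarrow> 'v mat" where
  "ext X = (THE Z. (X, Z) \<in> G)"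

lemma ext_eq:
  assumes "(X, Z) \<in> G"
  shows "ext X = Z"
  unfolding ext_def
proof (rule the_equality)
  obtain n where n: "X \<in> carrier_mat n n" "Z \<in> carrier_mat n n" using graph_carrier[OF assms] by blast
  show "Z' = Z" if "(X, Z') \<in> G" for Z'
    using graph_similarity[OF assms that simul_similar_refl[OF n]] .
qed (fact assms)

lemma ext_graph: "X \<in> Domain G \<Longrightarrow> (X, ext X) \<in> G"
  using ext_eq by (metis DomainE)

lemma ext_dsum:
  "X \<in> Domain G \<Longrightarrow> Y \<in> Domain G \<Longrightarrow> ext (dsum 0 X Y) = dsum 0 (ext X) (ext Y)"
  by (intro ext_eq dsum_graph.dsum ext_graph)

text \<open>Makes the extension a self-map of its domain: \<open>f\<close> maps
  \<open>\<Omega>\<close> into itself and \<open>W\<close> is kept fixed.\<close>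

lemma graph_range: "(X, Z) \<in> G \<Longrightarrow> Z \<in> Domain G"
proof (induction rule: dsum_graph.induct)
  case (mem A)
  then obtain n where "A \<in> carrier_mat n n" using supp_of_mem by (auto simp: level_def)
  then have "(f A, f (f A)) \<in> G" using mem f_carrier by (intro dsum_graph.mem)
  then show ?case by blast
next
  case (dsum X Z X' Z')
  then obtain U U' where "(Z, U) \<in> G" "(Z', U') \<in> G" by blast
  then have "(dsum 0 Z Z', dsum 0 U U') \<in> G" by (rule dsum_graph.dsum)
  then show ?case by blast
qed (use dsum_graph.star in blast)

lemma star_graph: "k \<ge> 1 \<Longrightarrow> (star k, star k) \<in> G"
proof (induction k rule: dec_induct)
  case base
  show ?case using dsum_graph.star[of W \<Omega> f] by (simp only: dsum_copies_1)
next
  case (step k)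
  then show ?case using dsum_graph.dsum[OF dsum_graph.star step.IH] by simp
qed

lemma nc_set_Domain: "nc_set (Domain G)"
  unfolding nc_set_def closed_under_dsum_def
proof (intro conjI ballI subsetI)
  fix X assume "X \<in> Domain G"
  then obtain Z where "(X, Z) \<in> G" by blast
  then obtain k where "k \<ge> 1" "X \<in> carrier_mat (k * d) (k * d)" using graph_carrier by blast
  then show "X \<in> nc_space" using d_pos by (auto simp: nc_space_def intro!: bexI[of _ "k * d"])
next
  show "dsum 0 X Y \<in> Domain G" if "X \<in> Domain G" "Y \<in> Domain G" for X Y
    using that dsum_graph.dsum by blast
qed

lemma level_Domain:
  assumes "X \<in> level (Domain G) n"
  shows "(X, ext X) \<in> G" "X \<in> carrier_mat n n" "ext X \<in> level (Domain G) n" "n \<in> {k * d |k. k \<ge> 1}"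
proof -
  show G: "(X, ext X) \<in> G" "X \<in> carrier_mat n n" using assms ext_graph by (auto simp: level_def)
  then show "ext X \<in> level (Domain G) n"
    using graph_range graph_carrier_snd by (auto simp: level_def)
  obtain k where k: "k \<ge> 1" "X \<in> carrier_mat (k * d) (k * d)" using graph_carrier[OF G(1)] by blast
  then have "n = k * d" using G(2) carrier_matD(1) by metis
  then show "n \<in> {k * d |k. k \<ge> 1}" using k(1) by blast
qed

lemma supp_Domain: "nc_supp (Domain G) = {k * d |k. k \<ge> 1}"
proof (intro equalityI subsetI)
  fix n assume "n \<in> {k * d |k. k \<ge> 1}"
  then obtain k where k: "n = k * d" "k \<ge> 1" by blast
  then have "star k \<in> level (Domain G) n" using star_graph[of k] star_carrier by (auto simp: level_def)
  then show "n \<in> nc_supp (Domain G)" using k d_pos by (auto simp: nc_supp_def)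
qed (use level_Domain(4) in \<open>auto simp: nc_supp_def\<close>)

lemma nc_function_ext: "nc_function smul (Domain G) ext"
  unfolding nc_function_def
proof (intro conjI allI ballI impI)
  show "ext ` level (Domain G) n \<subseteq> carrier_mat n n" for n
    using level_Domain(3) by (auto simp: level_def)
  fix n X S T
  assume X: "X \<in> level (Domain G) n" and ST: "S \<in> carrier_mat n n" "T \<in> carrier_mat n n"
    "inverts_mat S T" "inverts_mat T S"
    and Y: "mat_scal_mult smul (scal_mat_mult smul S X) T \<in> level (Domain G) n"
  have "simul_similar smul n (X, ext X) (mat_conj smul S T X, mat_conj smul S T (ext X))"
    using level_Domain(2,3)[OF X] ST by (intro simul_similarI) (auto simp: level_def inverts_mat_def)
  then show "ext (mat_scal_mult smul (scal_mat_mult smul S X) T)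
      = mat_scal_mult smul (scal_mat_mult smul S (ext X)) T"
    using graph_similarity[OF level_Domain(1)[OF X] level_Domain(1)[OF Y]] by (simp add: mat_conj_def)
qed (simp_all add: nc_set_Domain ext_dsum)

section \<open>Contraction constants and completeness of the levels\<close>

text \<open>A matrix of size \<open>n\<close> may contain summands from \<open>\<Omega>\<close> of
  any smaller size in the support, so the constant dominates all their \<open>c p\<close>. The
  inserted 0 covers the case that there are none.\<close>

definition C :: "nat \<Rightarrow> real" where
  "C n = Max (insert 0 (c ` {p \<in> nc_supp \<Omega>. p \<le> n}))"

lemma C_bounds: "0 \<le> C n" "C n < 1" "p \<in> nc_supp \<Omega> \<Longrightarrow> p \<le> n \<Longrightarrow> c p \<le> C n"
proof -
  have fin: "finite (insert 0 (c ` {p \<in> nc_supp \<Omega>. p \<le> n}))" by simp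
  show "0 \<le> C n" unfolding C_def using fin by (rule Max_ge) simp
  show "C n < 1" unfolding C_def using fin const by (subst Max_less_iff) auto
  show "c p \<le> C n" if "p \<in> nc_supp \<Omega>" "p \<le> n"
    unfolding C_def using fin by (rule Max_ge) (use that in simp)
qed

lemma C_mono: "n \<le> m \<Longrightarrow> C n \<le> C m"
  unfolding C_def by (intro Max_mono) auto

text \<open>The comparison point \<open>star k\<close> splits along with every decomposition of
  \<open>X\<close>, so both norms become maxima over the summands and the induction goes through.
  Two arbitrary points need not have a common decomposition, which is why the estimate concerns
  distances to the fixed point.\<close>

lemma graph_contraction:
  assumes "(X, Z) \<in> G" "X \<in> carrier_mat (k * d) (k * d)"
  shows "nrm (k * d) (Z - star k) \<le> C (k * d) * nrm (k * d) (X - star k)"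
  using assms
proof (induction arbitrary: k)
  case (mem A)
  obtain m where m: "m \<in> nc_supp \<Omega>" "A \<in> level \<Omega> m" using supp_of_mem[OF mem(1)] by blast
  have "A \<in> carrier_mat m m" using m(2) by (simp add: level_def)
  then have "m = k * d" using carrier_matD(1) mem(2) by metis
  with m have n: "k * d \<in> nc_supp \<Omega>" "A \<in> level \<Omega> (k * d)" by (simp_all only:)
  note s = star_mem[OF n(1)]
  have sl: "star k \<in> level \<Omega> (k * d)" using s star_carrier by (simp add: level_def)
  have fl: "f A \<in> level \<Omega> (k * d)" using n maps by blast
  have "nrm (k * d) (f A - star k) \<le> c (k * d) * nrm (k * d) (A - star k)"
    using contraction[OF n sl] rho[OF n sl] rho[OF n(1) fl sl] s(2) by simp
  also have "\<dots> \<le> C (k * d) * nrm (k * d) (A - star k)"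
    using n star_carrier
    by (intro mult_right_mono C_bounds nrm_nonneg minus_carrier_mat) (auto simp: nc_supp_def)
  finally show ?case .
next
  case star
  then have "k * d = d" using W carrier_matD(1) by metis
  then have "k = 1" using d_pos by simp
  then have "star k = W" by (simp only: dsum_copies_1)
  then show ?case using \<open>k = 1\<close> nrm_self[OF d_pos W] by simp
next
  case (dsum X Z X' Z')
  obtain p where p: "p \<ge> 1" "X \<in> carrier_mat (p * d) (p * d)" "Z \<in> carrier_mat (p * d) (p * d)"
    using graph_carrier[OF dsum.hyps(1)] by blast
  obtain q where q: "q \<ge> 1" "X' \<in> carrier_mat (q * d) (q * d)" "Z' \<in> carrier_mat (q * d) (q * d)"
    using graph_carrier[OF dsum.hyps(2)] by blast
  have "k * d = p * d + q * d"
    using dsum.prems dsum_carrier[OF p(2) q(2)] carrier_matD(1) by metis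
  then have "k * d = (p + q) * d" by (simp only: add_mult_distrib)
  then have k: "k = p + q" using d_pos by simp
  have pq: "p * d \<ge> 1" "q * d \<ge> 1" using p q d_pos by simp_all
  have "nrm (p * d) (Z - star p) \<le> C (k * d) * nrm (p * d) (X - star p)"
    using dsum.IH(1)[OF p(2)] pq p star_carrier C_mono[of "p * d" "k * d"]
    by (elim order_trans) (auto simp: k intro!: mult_right_mono nrm_nonneg minus_carrier_mat)
  moreover have "nrm (q * d) (Z' - star q) \<le> C (k * d) * nrm (q * d) (X' - star q)"
    using dsum.IH(2)[OF q(2)] pq q star_carrier C_mono[of "q * d" "k * d"]
    by (elim order_trans) (auto simp: k intro!: mult_right_mono nrm_nonneg minus_carrier_mat)
  moreover have "C (k * d) * max a b = max (C (k * d) * a) (C (k * d) * b)" for a b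
    using C_bounds(1)[of "k * d"] by (simp add: max_mult_distrib_left)
  ultimately have "max (nrm (p * d) (Z - star p)) (nrm (q * d) (Z' - star q))
      \<le> C (k * d) * max (nrm (p * d) (X - star p)) (nrm (q * d) (X' - star q))"
    by (simp only: max.mono)
  then show ?case
    using p q pq star_carrier by (simp add: k add_mult_distrib nrm_dsum_diff flip: star_add)
qed

text \<open>A matrix of size \<open>n\<close> in the domain lies in \<open>\<Omega>\<close>, equals
  \<open>W\<close>, or splits into two smaller elements of the domain. Strong induction thus
  presents the level as a finite union of complete sets.\<close>

lemma level_Domain_complete:
  assumes "n \<ge> 1"
  shows "complete_metric_on (level (Domain G) n) (\<lambda>X Y. nrm n (X - Y))"
  using assms
proof (induction n rule: less_induct)
  case (less n)
  let ?A = "\<lambda>p. (\<lambda>(X, Y). dsum 0 X Y) ` (level (Domain G) p \<times> level (Domain G) (n - p))"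
  have M: "Metric_space (carrier_mat n n) (dist_on (carrier_mat n n) (\<lambda>X Y. nrm n (X - Y)))"
    using less.prems by (rule metric_space_nrm)
  have sub: "?A p \<subseteq> carrier_mat n n" if "p \<in> {1..<n}" for p
    using that dsum_carrier[of _ p _ "n - p"] by (auto simp: level_def)
  \<comment> \<open>The cut \<open>p\<close> runs over all sizes strictly between 0 and
    \<open>n\<close>; when \<open>p\<close> is not a multiple of \<open>d\<close>, the set
    \<open>?A p\<close> is empty.\<close>
  have "level (Domain G) n = (level \<Omega> n \<union> ({W} \<inter> carrier_mat n n)) \<union> (\<Union>p\<in>{1..<n}. ?A p)"
  proof (intro equalityI subsetI)
    fix X assume "X \<in> level (Domain G) n"
    then have "(X, ext X) \<in> G" "X \<in> carrier_mat n n" using level_Domain by blast+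
    then show "X \<in> (level \<Omega> n \<union> ({W} \<inter> carrier_mat n n)) \<union> (\<Union>p\<in>{1..<n}. ?A p)"
    proof cases
      case (dsum Y Z Y' Z')
      obtain p where p: "p \<ge> 1" "Y \<in> carrier_mat (p * d) (p * d)" using graph_carrier[OF dsum(3)] by blast
      obtain q where q: "q \<ge> 1" "Y' \<in> carrier_mat (q * d) (q * d)" using graph_carrier[OF dsum(4)] by blast
      have "X \<in> carrier_mat (p * d + q * d) (p * d + q * d)"
        unfolding dsum(1) using p(2) q(2) by (rule dsum_carrier)
      then have n: "n = p * d + q * d" using \<open>X \<in> carrier_mat n n\<close> carrier_matD(1) by metis
      have "Y \<in> level (Domain G) (p * d)" "Y' \<in> level (Domain G) (n - p * d)"
        using dsum(3,4) p(2) q(2) unfolding n level_def by auto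
      then have "X \<in> ?A (p * d)" unfolding dsum(1) by blast
      moreover have "p * d \<in> {1..<n}" using p q d_pos by (simp add: n)
      ultimately show ?thesis by (intro UnI2 UN_I)
    qed (simp_all add: level_def)
  next
    fix X assume "X \<in> (level \<Omega> n \<union> ({W} \<inter> carrier_mat n n)) \<union> (\<Union>p\<in>{1..<n}. ?A p)"
    then consider "X \<in> level \<Omega> n" | "X \<in> {W} \<inter> carrier_mat n n" | p where "p \<in> {1..<n}" "X \<in> ?A p"
      by blast
    then show "X \<in> level (Domain G) n"
    proof cases
      case 1
      then show ?thesis using dsum_graph.mem[of X \<Omega> f W] by (auto simp: level_def)
    next
      case 2
      then show ?thesis using dsum_graph.star[of W \<Omega> f] by (auto simp: level_def)
    next
      case 3
      have "X \<in> carrier_mat n n" using 3(2) sub[OF 3(1)] by (rule rev_subsetD)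
      moreover have "X \<in> Domain G"
        using 3(2) by (auto simp: level_def intro: DomainI dsum_graph.dsum)
      ultimately show ?thesis by (simp add: level_def)
    qed
  qed
  moreover have "complete_metric_on (level \<Omega> n) (\<lambda>X Y. nrm n (X - Y))"
  proof (cases "n \<in> nc_supp \<Omega>")
    case True
    then have "dist_on (level \<Omega> n) (\<rho> n) = dist_on (level \<Omega> n) (\<lambda>X Y. nrm n (X - Y))"
      using rho by (auto simp: dist_on_def fun_eq_iff)
    then show ?thesis using complete[OF True] by (simp add: complete_metric_on_def)
  next
    case False
    then have "level \<Omega> n = {}" using less.prems by (simp add: nc_supp_def)
    then show ?thesis by (simp add: complete_metric_on_empty)
  qed
  moreover have "complete_metric_on ({W} \<inter> carrier_mat n n) (\<lambda>X Y. nrm n (X - Y))"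
  proof (cases "W \<in> carrier_mat n n")
    case True
    then show ?thesis using complete_singleton[OF less.prems True] by simp
  qed (simp add: complete_metric_on_empty)
  moreover have "complete_metric_on (\<Union>p\<in>{1..<n}. ?A p) (\<lambda>X Y. nrm n (X - Y))"
  proof (intro complete_metric_on_finite_Union[OF M] conjI sub)
    fix p assume p: "p \<in> {1..<n}"
    then have "complete_metric_on (?A p) (\<lambda>X Y. nrm (p + (n - p)) (X - Y))"
      by (intro complete_dsum_image less.IH) (auto simp: level_def)
    then show "complete_metric_on (?A p) (\<lambda>X Y. nrm n (X - Y))" using p by simp
  qed auto
  moreover have "level \<Omega> n \<subseteq> carrier_mat n n" by (auto simp: level_def)
  moreover have "(\<Union>p\<in>{1..<n}. ?A p) \<subseteq> carrier_mat n n" using sub by (rule UN_least)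
  ultimately show ?case
    by (simp only:) (intro complete_metric_on_Un[OF M] Un_least Int_lower2)
qed

section \<open>Convergence of the iterates and assembly of the conclusions\<close>

lemma ext_iterates:
  assumes "k \<ge> 1" "X \<in> level (Domain G) (k * d)"
  shows "(ext ^^ j) X \<in> level (Domain G) (k * d) \<and>
    nrm (k * d) ((ext ^^ j) X - star k) \<le> C (k * d) ^ j * nrm (k * d) (X - star k)"
proof (induction j)
  case (Suc j)
  let ?Y = "(ext ^^ j) X"
  have Y: "?Y \<in> level (Domain G) (k * d)" using Suc by blast
  have "nrm (k * d) (ext ?Y - star k) \<le> C (k * d) * nrm (k * d) (?Y - star k)"
    using level_Domain(1,2)[OF Y] by (rule graph_contraction)
  also have "\<dots> \<le> C (k * d) * (C (k * d) ^ j * nrm (k * d) (X - star k))"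
    using Suc C_bounds(1) by (intro mult_left_mono) auto
  finally show ?case using level_Domain(3)[OF Y] by simp
qed (use assms in simp)

text \<open>The witnesses are \<open>Domain G\<close> and \<open>ext\<close>, and \<open>C n\<close>
  is the constant both for the estimate towards the fixed point and for the rate of convergence. It
  dominates \<open>c n\<close> because \<open>n\<close> itself is among the sizes in its
  maximum.\<close>

lemma extension:
  "\<exists>\<Omega>' f'.
    nc_set \<Omega>' \<and> \<Omega> \<subseteq> \<Omega>' \<and> nc_supp \<Omega>' = {k * d |k. k \<ge> 1} \<and>
    nc_function smul \<Omega>' f' \<and> f' ` \<Omega>' \<subseteq> \<Omega>' \<and> (\<forall>X\<in>\<Omega>. f' X = f X) \<and>
    (\<forall>n\<in>{k * d |k. k \<ge> 1}.
       let Xn = dsum_copies 0 (n div d) W in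
       {X \<in> level \<Omega>' n. f' X = X} = {Xn} \<and>
       complete_metric_on (level \<Omega>' n) (\<lambda>X Y. nrm n (X - Y)) \<and>
       (n \<in> nc_supp \<Omega> \<longrightarrow>
          (\<forall>X\<in>level \<Omega> n. \<forall>Y\<in>level \<Omega> n. nrm n (X - Y) = \<rho> n X Y)) \<and>
       (\<exists>c'. 0 \<le> c' \<and> c' < 1 \<and> (n \<in> nc_supp \<Omega> \<longrightarrow> c n \<le> c') \<and>
          (\<forall>X\<in>level \<Omega>' n. nrm n (f' X - f' Xn) \<le> c' * nrm n (X - Xn)) \<and>
          (\<forall>X0\<in>level \<Omega>' n.
             (\<lambda>j. nrm n ((f' ^^ j) X0 - Xn)) \<longlonglongrightarrow> 0 \<and>
             (\<forall>j\<ge>1. nrm n ((f' ^^ j) X0 - Xn) \<le> c' ^ j * nrm n (X0 - Xn)))))"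
proof (rule exI[of _ "Domain G"], rule exI[of _ ext], intro conjI ballI)
  show "\<Omega> \<subseteq> Domain G" using dsum_graph.mem[of _ \<Omega> f W] by blast
  show "ext ` Domain G \<subseteq> Domain G" using ext_graph graph_range by blast
  show "ext X = f X" if "X \<in> \<Omega>" for X using that by (intro ext_eq dsum_graph.mem)
next
  fix n assume "n \<in> {k * d |k. k \<ge> 1}"
  then obtain k where k: "n = k * d" "k \<ge> 1" by blast
  have n1: "k * d \<ge> 1" using k d_pos by simp
  have sl: "star k \<in> level (Domain G) (k * d)"
    using star_graph[OF k(2)] star_carrier by (auto simp: level_def)
  have ext_star: "ext (star k) = star k" by (rule ext_eq[OF star_graph[OF k(2)]])
  have contr: "nrm (k * d) (ext X - star k) \<le> C (k * d) * nrm (k * d) (X - star k)"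
    if "X \<in> level (Domain G) (k * d)" for X
    using level_Domain(1,2)[OF that] by (rule graph_contraction)
  \<comment> \<open>The estimate towards \<open>star k\<close> alone excludes another fixed point:
    its distance to \<open>star k\<close> would be at most a factor below 1 times itself.\<close>
  have fix_eq: "X = star k" if X: "X \<in> level (Domain G) (k * d)" "ext X = X" for X
  proof (rule nrm_diff_eq_0[OF n1 level_Domain(2)[OF X(1)] star_carrier], rule ccontr)
    assume "nrm (k * d) (X - star k) \<noteq> 0"
    then have "nrm (k * d) (X - star k) > 0"
      using nrm_nonneg[OF n1 minus_carrier_mat[OF star_carrier], of X] by simp
    then have "C (k * d) * nrm (k * d) (X - star k) < 1 * nrm (k * d) (X - star k)"
      by (intro mult_strict_right_mono C_bounds)
    then show False using contr[OF X(1)] X(2) by simp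
  qed
  have lim: "(\<lambda>j. nrm (k * d) ((ext ^^ j) X - star k)) \<longlonglongrightarrow> 0" if X: "X \<in> level (Domain G) (k * d)" for X
  proof (rule tendsto_sandwich[OF always_eventually always_eventually tendsto_const])
    show "\<forall>j. 0 \<le> nrm (k * d) ((ext ^^ j) X - star k)"
      using n1 star_carrier by (intro allI nrm_nonneg minus_carrier_mat)
    show "\<forall>j. nrm (k * d) ((ext ^^ j) X - star k) \<le> C (k * d) ^ j * nrm (k * d) (X - star k)"
      using ext_iterates[OF k(2) X] by blast
    show "(\<lambda>j. C (k * d) ^ j * nrm (k * d) (X - star k)) \<longlonglongrightarrow> 0"
      using C_bounds by (intro tendsto_mult_left_zero LIMSEQ_power_zero) simp
  qed
  have kd: "k * d div d = k" using d_pos by simp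
  show "let Xn = dsum_copies 0 (n div d) W in
     {X \<in> level (Domain G) n. ext X = X} = {Xn} \<and>
     complete_metric_on (level (Domain G) n) (\<lambda>X Y. nrm n (X - Y)) \<and>
     (n \<in> nc_supp \<Omega> \<longrightarrow>
        (\<forall>X\<in>level \<Omega> n. \<forall>Y\<in>level \<Omega> n. nrm n (X - Y) = \<rho> n X Y)) \<and>
     (\<exists>c'. 0 \<le> c' \<and> c' < 1 \<and> (n \<in> nc_supp \<Omega> \<longrightarrow> c n \<le> c') \<and>
        (\<forall>X\<in>level (Domain G) n. nrm n (ext X - ext Xn) \<le> c' * nrm n (X - Xn)) \<and>
        (\<forall>X0\<in>level (Domain G) n.
           (\<lambda>j. nrm n ((ext ^^ j) X0 - Xn)) \<longlonglongrightarrow> 0 \<and>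
           (\<forall>j\<ge>1. nrm n ((ext ^^ j) X0 - Xn) \<le> c' ^ j * nrm n (X0 - Xn))))"
    unfolding Let_def k(1) kd
  proof (intro conjI impI ballI allI exI[of _ "C (k * d)"])
    show "{X \<in> level (Domain G) (k * d). ext X = X} = {star k}" using sl ext_star fix_eq by blast
    show "complete_metric_on (level (Domain G) (k * d)) (\<lambda>X Y. nrm (k * d) (X - Y))"
      using n1 by (rule level_Domain_complete)
    show "nrm (k * d) (X - Y) = \<rho> (k * d) X Y"
      if "k * d \<in> nc_supp \<Omega>" "X \<in> level \<Omega> (k * d)" "Y \<in> level \<Omega> (k * d)" for X Y
      using rho[OF that] by (rule sym)
    show "nrm (k * d) (ext X - ext (star k)) \<le> C (k * d) * nrm (k * d) (X - star k)"
      if "X \<in> level (Domain G) (k * d)" for X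
      unfolding ext_star using that by (rule contr)
    show "nrm (k * d) ((ext ^^ j) X - star k) \<le> C (k * d) ^ j * nrm (k * d) (X - star k)"
      if "X \<in> level (Domain G) (k * d)" for X j
      using ext_iterates[OF k(2) that] by blast
    show "c (k * d) \<le> C (k * d)" if "k * d \<in> nc_supp \<Omega>"
      using that order_refl by (rule C_bounds(3))
  qed (fact C_bounds(1) C_bounds(2) lim)+
qed (rule nc_set_Domain supp_Domain nc_function_ext)+

end

text \<open>Repackages the hypotheses in the form in which the theorem supplies them, with
  \<open>d\<close> replaced by the greatest common divisor.\<close>

lemma nc_fixed_pointI:
  assumes "nc_contraction 0 \<Omega> \<rho> f c" "operator_space smul nrm"
    "\<forall>n\<in>nc_supp \<Omega>. \<forall>X\<in>level \<Omega> n. \<forall>Y\<in>level \<Omega> n. \<rho> n X Y = nrm n (X - Y)"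
    "nc_function smul \<Omega> f" "W \<in> carrier_mat (Gcd (nc_supp \<Omega>)) (Gcd (nc_supp \<Omega>))"
    "\<forall>n\<in>nc_supp \<Omega>. {X \<in> level \<Omega> n. f X = X} = {dsum_copies 0 (n div Gcd (nc_supp \<Omega>)) W}"
  shows "nc_fixed_point smul nrm \<Omega> \<rho> f c W (Gcd (nc_supp \<Omega>))"
  using assms by (intro nc_fixed_point.intro nc_fixed_point_axioms.intro) (rule refl | assumption | blast)+

text \<open>The two scalar fields appear as separate conjuncts. In them \<open>Xs\<close> is any
  block with the property established by the first conjunct, so the extension is obtained for the
  very block found there.\<close>

theorem theorem8:
  shows "(\<forall>(z :: 'a) \<Omega> \<rho> f c.
     let d = Gcd (nc_supp \<Omega>) in
     nc_contraction z \<Omega> \<rho> f c \<longrightarrow>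
     (\<exists>Xs\<in>carrier_mat d d.
        \<forall>n\<in>nc_supp \<Omega>. {X \<in> level \<Omega> n. f X = X} = {dsum_copies z (n div d) Xs})) \<and>
  (\<forall>(smul :: real \<Rightarrow> 'v::ab_group_add \<Rightarrow> 'v) (nrm :: nat \<Rightarrow> 'v mat \<Rightarrow> real)
      (\<Omega> :: 'v mat set) \<rho> f c Xs.
     let d = Gcd (nc_supp \<Omega>) in
     nc_contraction 0 \<Omega> \<rho> f c \<longrightarrow>
     operator_space smul nrm \<longrightarrow>
     (\<forall>n\<in>nc_supp \<Omega>. \<forall>X\<in>level \<Omega> n. \<forall>Y\<in>level \<Omega> n. \<rho> n X Y = nrm n (X - Y)) \<longrightarrow>
     nc_function smul \<Omega> f \<longrightarrow>
     Xs \<in> carrier_mat d d \<longrightarrow>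
     (\<forall>n\<in>nc_supp \<Omega>. {X \<in> level \<Omega> n. f X = X} = {dsum_copies 0 (n div d) Xs}) \<longrightarrow>
     (\<exists>\<Omega>' f'.
        nc_set \<Omega>' \<and> \<Omega> \<subseteq> \<Omega>' \<and> nc_supp \<Omega>' = {k * d |k. k \<ge> 1} \<and>
        nc_function smul \<Omega>' f' \<and> f' ` \<Omega>' \<subseteq> \<Omega>' \<and> (\<forall>X\<in>\<Omega>. f' X = f X) \<and>
        (\<forall>n\<in>{k * d |k. k \<ge> 1}.
           let Xn = dsum_copies 0 (n div d) Xs in
           {X \<in> level \<Omega>' n. f' X = X} = {Xn} \<and>
           complete_metric_on (level \<Omega>' n) (\<lambda>X Y. nrm n (X - Y)) \<and>
           (n \<in> nc_supp \<Omega> \<longrightarrow>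
              (\<forall>X\<in>level \<Omega> n. \<forall>Y\<in>level \<Omega> n. nrm n (X - Y) = \<rho> n X Y)) \<and>
           (\<exists>c'. 0 \<le> c' \<and> c' < 1 \<and> (n \<in> nc_supp \<Omega> \<longrightarrow> c n \<le> c') \<and>
              (\<forall>X\<in>level \<Omega>' n. nrm n (f' X - f' Xn) \<le> c' * nrm n (X - Xn)) \<and>
              (\<forall>X0\<in>level \<Omega>' n.
                 (\<lambda>j. nrm n ((f' ^^ j) X0 - Xn)) \<longlonglongrightarrow> 0 \<and>
                 (\<forall>j\<ge>1. nrm n ((f' ^^ j) X0 - Xn) \<le> c' ^ j * nrm n (X0 - Xn))))))) \<and>
  (\<forall>(smul :: complex \<Rightarrow> 'v::ab_group_add \<Rightarrow> 'v) (nrm :: nat \<Rightarrow> 'v mat \<Rightarrow> real)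
      (\<Omega> :: 'v mat set) \<rho> f c Xs.
     let d = Gcd (nc_supp \<Omega>) in
     nc_contraction 0 \<Omega> \<rho> f c \<longrightarrow>
     operator_space smul nrm \<longrightarrow>
     (\<forall>n\<in>nc_supp \<Omega>. \<forall>X\<in>level \<Omega> n. \<forall>Y\<in>level \<Omega> n. \<rho> n X Y = nrm n (X - Y)) \<longrightarrow>
     nc_function smul \<Omega> f \<longrightarrow>
     Xs \<in> carrier_mat d d \<longrightarrow>
     (\<forall>n\<in>nc_supp \<Omega>. {X \<in> level \<Omega> n. f X = X} = {dsum_copies 0 (n div d) Xs}) \<longrightarrow>
     (\<exists>\<Omega>' f'.
        nc_set \<Omega>' \<and> \<Omega> \<subseteq> \<Omega>' \<and> nc_supp \<Omega>' = {k * d |k. k \<ge> 1} \<and>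
        nc_function smul \<Omega>' f' \<and> f' ` \<Omega>' \<subseteq> \<Omega>' \<and> (\<forall>X\<in>\<Omega>. f' X = f X) \<and>
        (\<forall>n\<in>{k * d |k. k \<ge> 1}.
           let Xn = dsum_copies 0 (n div d) Xs in
           {X \<in> level \<Omega>' n. f' X = X} = {Xn} \<and>
           complete_metric_on (level \<Omega>' n) (\<lambda>X Y. nrm n (X - Y)) \<and>
           (n \<in> nc_supp \<Omega> \<longrightarrow>
              (\<forall>X\<in>level \<Omega> n. \<forall>Y\<in>level \<Omega> n. nrm n (X - Y) = \<rho> n X Y)) \<and>
           (\<exists>c'. 0 \<le> c' \<and> c' < 1 \<and> (n \<in> nc_supp \<Omega> \<longrightarrow> c n \<le> c') \<and>
              (\<forall>X\<in>level \<Omega>' n. nrm n (f' X - f' Xn) \<le> c' * nrm n (X - Xn)) \<and>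
              (\<forall>X0\<in>level \<Omega>' n.
                 (\<lambda>j. nrm n ((f' ^^ j) X0 - Xn)) \<longlonglongrightarrow> 0 \<and>
                 (\<forall>j\<ge>1. nrm n ((f' ^^ j) X0 - Xn) \<le> c' ^ j * nrm n (X0 - Xn)))))))"
proof (intro conjI allI)
  fix z :: 'a and \<Omega> \<rho> f c
  show "let d = Gcd (nc_supp \<Omega>) in
     nc_contraction z \<Omega> \<rho> f c \<longrightarrow>
     (\<exists>Xs\<in>carrier_mat d d.
        \<forall>n\<in>nc_supp \<Omega>. {X \<in> level \<Omega> n. f X = X} = {dsum_copies z (n div d) Xs})"
    unfolding Let_def by (rule impI) (rule nc_contraction.fixed_points_copies)
\<comment> \<open>The real and the complex conjunct are instances of one and the same extension
  result.\<close>
qed (unfold Let_def, (intro impI, rule nc_fixed_point.extension[unfolded Let_def, OF nc_fixed_pointI],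
      assumption+)+)

end
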